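(* There are constants $0<\lambda_0<\infty$ and $0<\varepsilon_0<1$ such that the following hold for $p=\frac1{2n}(1+\varepsilon)=\frac1{2n}(1+\lambda_n n^{-1/3})$ with $\lambda_0\le|\lambda_n|\le\varepsilon_0n^{1/3}$ and any literal $x$. (i) If $\varepsilon<0$, then \[ \Pr\big(x\underset{F_{n,p}}{\rightsquigarrow}\overline x\big)=\frac{n^{-1/3}}{4\lambda_n^2}\big(1+o(1)\big), \] where $o(1)\to0$ as $|\lambda_n|\to\infty$ and $\varepsilon\to0$. (ii) If $\varepsilon>0$, then \[ \Pr\big(x\underset{F_{n,p}}{\rightsquigarrow}\overline x\big)=\vartheta(\varepsilon)\big(1+o_{\lambda_n}(1)\big)=2\lambda_n n^{-1/3}\big(1+o_{\lambda_n}(1)+O(\varepsilon)\big). \]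
   Context: Variables $x_1,\dots,x_n$, literals $x_i,\overline x_i$; a 2-clause is $u\vee v$ with $u\ne v$, $u\ne\overline v$, and $u\vee v=v\vee u$, giving $4\binom n2$ clauses. $F_{n,p}$ is the random 2-SAT formula containing each of these clauses independently with probability $p$. The digraph $D_F$ on the literals has an edge $x\to y$ iff $\overline x\vee y$ is a clause of $F$; $x\underset{F}{\rightsquigarrow}y$ means $D_F$ has a directed path from $x$ to $y$. For $\varepsilon>0$, $\vartheta(\varepsilon)\in(0,1)$ is defined by $1-\vartheta(\varepsilon)=\exp[-(1+\varepsilon)\vartheta(\varepsilon)]$. Landau conventions: $O(g)$ means bounded by a universal constant times $|g|$; $f=o_{\lambda_n}(g)$ means $f/g$ is uniformly bounded and tends to $0$ as $\lambda_n\to\infty$ (and $o(1)$ with stated limits similarly requires uniform boundedness). *)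

theory Defs
  imports "HOL-Probability.Probability" "HOL-Library.Landau_Symbols"
begin

section \<open>Random 2-SAT formulas\<close>

datatype literal = Pos nat | Neg nat

fun var :: "literal \<Rightarrow> nat" where
  "var (Pos i) = i"
| "var (Neg i) = i"

fun negate :: "literal \<Rightarrow> literal" where
  "negate (Pos i) = Neg i"
| "negate (Neg i) = Pos i"

definition literals :: "nat \<Rightarrow> literal set" where
  "literals n = {u. var u \<in> {1..n}}"

text \<open>The 2-clause \<open>u \<or> v\<close> is the unordered pair \<open>{u, v}\<close>; a formula is a set of clauses.\<close>

definition clauses :: "nat \<Rightarrow> literal set set" where
  "clauses n = {{u, v} | u v. u \<in> literals n \<and> v \<in> literals n \<and> u \<noteq> v \<and> u \<noteq> negate v}"

definition formula_digraph :: "literal set set \<Rightarrow> (literal \<times> literal) set" where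
  "formula_digraph F = {(x, y). {negate x, y} \<in> F}"

definition reaches :: "literal set set \<Rightarrow> literal \<Rightarrow> literal \<Rightarrow> bool" where
  "reaches F x y \<longleftrightarrow> (x, y) \<in> (formula_digraph F)\<^sup>*"

definition random_formula :: "nat \<Rightarrow> real \<Rightarrow> literal set set pmf" where
  "random_formula n p =
     map_pmf (\<lambda>f. {c \<in> clauses n. f c}) (Pi_pmf (clauses n) False (\<lambda>_. bernoulli_pmf p))"

definition reach_prob :: "nat \<Rightarrow> real \<Rightarrow> literal \<Rightarrow> real" where
  "reach_prob n p x = measure_pmf.prob (random_formula n p) {F. reaches F x (negate x)}"

definition vartheta :: "real \<Rightarrow> real" where
  "vartheta \<epsilon> = (THE t. 0 < t \<and> t < 1 \<and> 1 - t = exp (- (1 + \<epsilon>) * t))"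

lemma vartheta_unique:
  fixes \<epsilon> :: real
  assumes "\<epsilon> > 0"
  shows "\<exists>!t. 0 < t \<and> t < 1 \<and> 1 - t = exp (- (1 + \<epsilon>) * t)"
proof -
  define g where "g t = 1 - t - exp (- (1 + \<epsilon>) * t)" for t :: real
  define g' where "g' t = - 1 + (1 + \<epsilon>) * exp (- (1 + \<epsilon>) * t)" for t :: real
  have der: "(g has_real_derivative g' t) (at t)" for t
    unfolding g_def g'_def by (auto intro!: derivative_eq_intros simp: algebra_simps)
  have cont: "continuous_on A g" for A
    unfolding g_def by (intro continuous_intros)
  have g0: "g 0 = 0" and g1: "g 1 < 0"
    by (simp_all add: g_def)
  have "g' 0 > 0"
    using assms by (simp add: g'_def)
  then obtain d where d: "d > 0" "\<And>h. 0 < h \<Longrightarrow> h < d \<Longrightarrow> g 0 < g (0 + h)"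
    using DERIV_pos_inc_right[OF der] by blast
  define a where "a = min (d / 2) (1 / 2)"
  have a: "0 < a" "a < 1" "g a > 0"
    using d(1) d(2)[of a] g0 by (auto simp: a_def)
  obtain t where t: "a \<le> t" "t \<le> 1" "g t = 0"
    using IVT2'[of g 1 0 a] a g1 cont by force
  have ex: "0 < t \<and> t < 1 \<and> g t = 0"
    using t a g1 by (cases "t = 1") auto
  have rolle: "\<exists>z. s < z \<and> z < u \<and> g' z = 0" if "s < u" "g s = g u" for s u
    using Rolle_deriv[of s u g "\<lambda>t h. g' t * h"] that cont
      der[THEN has_field_derivative_imp_has_derivative]
    by (metis mult.right_neutral)
  have no: False if su: "0 < s" "s < u" "g s = 0" "g u = 0" for s u
  proof -
    obtain y where y: "0 < y" "y < s" "g' y = 0"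
      using rolle[of 0 s] su g0 by auto
    obtain z where z: "s < z" "z < u" "g' z = 0"
      using rolle[of s u] su by auto
    have "(1 + \<epsilon>) * exp (- (1 + \<epsilon>) * y) = (1 + \<epsilon>) * exp (- (1 + \<epsilon>) * z)"
      using y z by (simp add: g'_def)
    then have "(1 + \<epsilon>) * y = (1 + \<epsilon>) * z"
      using assms by (simp del: mult_minus_left)
    then show False
      using y z assms by simp
  qed
  have eq: "1 - t = exp (- (1 + \<epsilon>) * t) \<longleftrightarrow> g t = 0" for t
    by (auto simp: g_def)
  show ?thesis
    unfolding eq using ex no by (metis linorder_neqE_linordered_idom)
qed

section \<open>Parameters and Landau conventions\<close>

text \<open>
  All error terms are functions of the whole parameter triple (number of variables, \<open>\<lambda>\<^sub>n\<close>, literal),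
  restricted to a set \<open>R\<close> of admissible triples.  Quantifying over all pairs \<open>(n, \<lambda>\<^sub>n)\<close> instead of
  fixing a sequence \<open>\<lambda>\<^sub>n\<close> expresses that the bounds and rates are universal.
\<close>

type_synonym param = "nat \<times> real \<times> literal"

definition eps :: "nat \<Rightarrow> real \<Rightarrow> real" where
  "eps n l = l * real n powr (-1/3)"

definition edge_prob :: "nat \<Rightarrow> real \<Rightarrow> real" where
  "edge_prob n l = 1 / (2 * real n) * (1 + eps n l)"

definition regime :: "real \<Rightarrow> real \<Rightarrow> param set" where
  "regime l0 e0 =
     {(n, l, x). l0 \<le> \<bar>l\<bar> \<and> \<bar>l\<bar> \<le> e0 * real n powr (1/3) \<and> x \<in> literals n}"

definition sub_regime :: "real \<Rightarrow> real \<Rightarrow> param set" where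
  "sub_regime l0 e0 = {(n, l, x) \<in> regime l0 e0. eps n l < 0}"

definition super_regime :: "real \<Rightarrow> real \<Rightarrow> param set" where
  "super_regime l0 e0 = {(n, l, x) \<in> regime l0 e0. eps n l > 0}"

text \<open>
  \<open>\<bar>\<lambda>\<^sub>n\<bar> \<rightarrow> \<infinity>\<close> and \<open>\<epsilon> \<rightarrow> 0\<close> as filters on parameter triples.  The bound \<open>f \<in> O[principal R](g)\<close>
  means that \<open>\<bar>f\<bar> \<le> C * \<bar>g\<bar>\<close> on all of \<open>R\<close> for one constant \<open>C\<close>.
\<close>

definition lambda_large :: "param filter" where
  "lambda_large = filtercomap (\<lambda>(n, l, x). \<bar>l\<bar>) at_top"

definition eps_small :: "param filter" where
  "eps_small = filtercomap (\<lambda>(n, l, x). eps n l) (nhds 0)"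

definition little_o_on :: "param filter \<Rightarrow> param set \<Rightarrow> (param \<Rightarrow> real) \<Rightarrow> (param \<Rightarrow> real) set" where
  "little_o_on \<F> R g = O[principal R](g) \<inter> o[inf \<F> (principal R)](g)"

end

theory Submission
  imports Defs
begin

text \<open>
  By contraposition in the digraph, \<open>x\<close> reaches its negation iff the set of literals reachable from
  \<open>x\<close> contains some literal together with its negation.  Exploring that set one literal at a time
  (unit propagation) uses every clause at most once, so the probability of never meeting such a pair
  obeys an exact linear recursion in two numbers: the active literals and the untouched variables.
  Each step kills the process with probability about \<open>p\<close> per active literal and otherwise
  moves the number of active literals like a random walk with drift about \<open>\<epsilon>\<close>.

  The recursion is estimated by explicit sub- and supersolutions.  Below the threshold they are
  perturbations of \<open>1 - c\<^sub>1 a - c\<^sub>2 a\<^sup>2\<close> with \<open>c\<^sub>1 = 1/(4n\<epsilon>\<^sup>2)\<close>, the expected killing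
  accumulated by a walk with drift \<open>-\<bar>\<epsilon>\<bar>\<close>.  Above the threshold they are perturbations of
  \<open>(1 - \<theta>)\<^sup>a\<close>, the probability that \<open>a\<close> independent branching processes all die out; surviving
  walks reach height of order \<open>\<epsilon>n\<close> and are killed.  All relative errors are governed by
  \<open>n\<bar>\<epsilon>\<bar>\<^sup>3 = \<bar>\<lambda>\<bar>\<^sup>3\<close>.
\<close>

section \<open>Unit propagation\<close>

text \<open>The two directions differ in difficulty because exploration uses up variables, so the
  drift falls as it proceeds. For an upper bound on the probability of a contradiction this helps: a
  comparison function of the number of active literals alone suffices, and one lemma serves both
  regimes after tilting by \<open>r = 1\<close> or by \<open>r = 1 - \<theta>\<close>. For a lower
  bound the drift has to persist until enough killing has accumulated. The supersolutions therefore
  carry a factor exponential in the number \<open>n - m\<close> of variables already touched, which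
  lifts them to 1 once the exploration leaves the range where drift and killing are controlled;
  there they are valid for the trivial reason that probabilities are at most 1. Such a factor must
  cost almost nothing at the start, and comparing the walk's time scale 1/e^2 with the depletion
  scale \<delta> e n is what forces n e^3 to be large. The accuracy parameters \<delta>, \<eta>, x
  are fixed first and the threshold for n e^3 depends only on them, which yields rates uniform in
  all pairs (n, \<lambda>).\<close>

definition lits :: "nat set \<Rightarrow> literal set" where
  "lits V = {u. var u \<in> V}"

definition clauses_on :: "nat set \<Rightarrow> literal set set" where
  "clauses_on V = {{u, v} | u v. u \<in> lits V \<and> v \<in> lits V \<and> u \<noteq> v \<and> u \<noteq> negate v}"

definition consistent :: "literal set \<Rightarrow> bool" where
  "consistent S \<longleftrightarrow> (\<forall>u\<in>S. negate u \<notin> S)"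

definition reach_set :: "literal set set \<Rightarrow> literal set \<Rightarrow> literal set" where
  "reach_set F A = (formula_digraph F)\<^sup>* `` A"

lemma negate_negate [simp]: "negate (negate u) = u"
  by (cases u) auto

lemma var_negate [simp]: "var (negate u) = var u"
  by (cases u) auto

lemma negate_neq [simp]: "negate u \<noteq> u" "u \<noteq> negate u"
  by (cases u; simp)+

lemma var_eq_iff: "var u = var v \<longleftrightarrow> u = v \<or> u = negate v"
  by (cases u; cases v) auto

lemma negate_inject [simp]: "negate u = negate v \<longleftrightarrow> u = v"
  by (metis negate_negate)

lemma clauses_eq: "clauses n = clauses_on {1..n}" "literals n = lits {1..n}"
  by (auto simp: clauses_def clauses_on_def literals_def lits_def)

lemma lits_insert: "lits (insert w V) = insert (Pos w) (insert (Neg w) (lits V))"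
proof -
  have "u \<in> lits (insert w V) \<longleftrightarrow> u \<in> insert (Pos w) (insert (Neg w) (lits V))" for u
    by (cases u) (auto simp: lits_def)
  then show ?thesis by blast
qed

lemma lits_empty [simp]: "lits {} = {}"
  by (simp add: lits_def)

lemma finite_lits: "finite V \<Longrightarrow> finite (lits V)"
  by (induction rule: finite_induct) (auto simp: lits_insert)

lemma finite_clauses_on: "finite V \<Longrightarrow> finite (clauses_on V)"
  by (rule finite_subset[of _ "Pow (lits V)"]) (auto simp: clauses_on_def finite_lits)

lemma pair_in_clauses_on:
  "{u, v} \<in> clauses_on V \<longleftrightarrow> u \<in> lits V \<and> v \<in> lits V \<and> u \<noteq> v \<and> u \<noteq> negate v"
  by (auto simp: clauses_on_def doubleton_eq_iff)

text \<open>The edges u -> v and \<open>negate v\<close> -> \<open>negate u\<close> come from one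
  and the same clause, so every path can be reversed with all its literals negated.\<close>

lemma digraph_contrapositive:
  "(x, y) \<in> (formula_digraph F)\<^sup>* \<Longrightarrow> (negate y, negate x) \<in> (formula_digraph F)\<^sup>*"
proof (induction rule: rtrancl_induct)
  case (step y z)
  then have "(negate z, negate y) \<in> formula_digraph F"
    by (simp add: formula_digraph_def insert_commute)
  with step show ?case by (meson converse_rtrancl_into_rtrancl)
qed simp

lemma reaches_negate_iff: "reaches F x (negate x) \<longleftrightarrow> \<not> consistent (reach_set F {x})"
proof
  assume "reaches F x (negate x)"
  then show "\<not> consistent (reach_set F {x})"
    by (auto simp: consistent_def reach_set_def reaches_def)
next
  assume "\<not> consistent (reach_set F {x})"
  then obtain y where y: "(x, y) \<in> (formula_digraph F)\<^sup>*" "(x, negate y) \<in> (formula_digraph F)\<^sup>*"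
    by (auto simp: consistent_def reach_set_def)
  from digraph_contrapositive[OF y(1)] y(2) show "reaches F x (negate x)"
    unfolding reaches_def by (meson rtrancl_trans)
qed

lemma consistent_subset: "consistent B \<Longrightarrow> A \<subseteq> B \<Longrightarrow> consistent A"
  by (auto simp: consistent_def)

lemma subset_reach_set: "A \<subseteq> reach_set F A"
  by (auto simp: reach_set_def)

lemma reach_set_least:
  assumes "A \<subseteq> B" "\<And>u w. u \<in> B \<Longrightarrow> {negate u, w} \<in> F \<Longrightarrow> w \<in> B"
  shows "reach_set F A \<subseteq> B"
proof -
  have "y \<in> B" if "(x, y) \<in> (formula_digraph F)\<^sup>*" "x \<in> B" for x y
    using that by (induction rule: rtrancl_induct) (use assms(2) in \<open>auto simp: formula_digraph_def\<close>)
  then show ?thesis using assms(1) by (auto simp: reach_set_def)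
qed

lemma reach_set_closed:
  "u \<in> reach_set F A \<Longrightarrow> {negate u, w} \<in> F \<Longrightarrow> w \<in> reach_set F A"
  unfolding reach_set_def formula_digraph_def
  by (auto intro: rtrancl_into_rtrancl)

text \<open>Once \<open>y\<close> is processed its variable can be deleted. Clauses containing
  \<open>negate y\<close> are used up in producing the successors of \<open>y\<close>. Clauses
  containing \<open>y\<close> give edges into \<open>y\<close>, which add nothing, and edges out of
  \<open>negate y\<close>, which matter only if \<open>negate y\<close> is reached; but a step into
  \<open>negate y\<close> already exposes a contradiction among the remaining literals.\<close>

lemma unit_propagation_step:
  assumes F: "F \<subseteq> clauses_on V" and A: "consistent A" "A \<subseteq> lits V" and y: "y \<in> A"
  shows "consistent (reach_set F A) \<longleftrightarrow>
    consistent (reach_set (F \<inter> clauses_on (V - {var y})) (A - {y} \<union> {z. {negate y, z} \<in> F}))"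
    (is "_ \<longleftrightarrow> consistent ?C")
proof
  assume "consistent (reach_set F A)"
  moreover have "?C \<subseteq> reach_set F A"
    using y subset_reach_set[of A F] reach_set_closed[of _ F A]
    by (intro reach_set_least) auto
  ultimately show "consistent ?C" by (rule consistent_subset)
next
  assume C: "consistent ?C"
  let ?V = "V - {var y}"
  have N: "z \<in> lits ?V" if "{negate y, z} \<in> F" for z
  proof -
    have "{negate y, z} \<in> clauses_on V" using that F by auto
    then show ?thesis by (auto simp: pair_in_clauses_on lits_def var_eq_iff)
  qed
  have A': "A - {y} \<subseteq> lits ?V"
    using A y by (auto simp: lits_def var_eq_iff consistent_def)
  have CV: "?C \<subseteq> lits ?V"
    using N A' by (intro reach_set_least) (auto simp: pair_in_clauses_on)
  have "reach_set F A \<subseteq> insert y ?C"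
  proof (rule reach_set_least)
    show "A \<subseteq> insert y ?C"
      using subset_reach_set[of "A - {y} \<union> {z. {negate y, z} \<in> F}"] by blast
  next
    fix u w assume u: "u \<in> insert y ?C" and e: "{negate u, w} \<in> F"
    have sub: "{z. {negate y, z} \<in> F} \<subseteq> ?C"
      using subset_reach_set[of "A - {y} \<union> {z. {negate y, z} \<in> F}"] by blast
    show "w \<in> insert y ?C"
    proof (cases "u = y")
      case True
      then show ?thesis using e sub by auto
    next
      case False
      with u have uC: "u \<in> ?C" by simp
      have "{negate u, w} \<in> clauses_on V" using e F by auto
      then have w: "w \<in> lits V" "negate u \<noteq> w" "u \<noteq> w"
        by (auto simp: pair_in_clauses_on)
      consider "w = y" | "w = negate y" | "w \<in> lits ?V"
        using w by (auto simp: lits_def var_eq_iff)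
      then show ?thesis
      proof cases
        \<comment> \<open>The edge from \<open>u\<close> to \<open>negate y\<close> is also an edge
          from \<open>y\<close> to \<open>negate u\<close>, so \<open>?C\<close> would contain both
          \<open>u\<close> and \<open>negate u\<close>.\<close>
        case 2
        then have "negate u \<in> ?C" using e sub by (auto simp: insert_commute)
        then show ?thesis using uC C by (auto simp: consistent_def)
      next
        case 3
        then have "{negate u, w} \<in> F \<inter> clauses_on ?V"
          using e uC CV w by (auto simp: pair_in_clauses_on lits_def)
        then show ?thesis using reach_set_closed[OF uC] by blast
      qed simp
    qed
  qed
  moreover have "consistent (insert y ?C)"
    unfolding consistent_def
  proof
    fix u assume u: "u \<in> insert y ?C"
    have *: "v \<noteq> negate y" "negate v \<noteq> y" if "v \<in> ?C" for v
      using that CV by (auto simp: lits_def)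
    show "negate u \<notin> insert y ?C"
      using u * C by (auto simp: consistent_def)
  qed
  ultimately show "consistent (reach_set F A)" by (meson consistent_subset)
qed

section \<open>Exact recursion for the probability of no contradiction\<close>

text \<open>Expectation over a random subset, kept as a polynomial in \<open>p\<close>: independence
  becomes the splitting of a finite sum, and the recursion is an identity for every real
  \<open>p\<close>. Measure theory and the range of \<open>p\<close> enter only in
  \<open>prob_random_subset\<close>.\<close>

definition subset_mean :: "real \<Rightarrow> 'a set \<Rightarrow> ('a set \<Rightarrow> real) \<Rightarrow> real" where
  "subset_mean p C f = (\<Sum>F\<in>Pow C. p ^ card F * (1 - p) ^ card (C - F) * f F)"

lemma subset_mean_empty [simp]: "subset_mean p {} f = f {}"
  by (simp add: subset_mean_def)

lemma subset_mean_insert: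
  assumes "finite C" "c \<notin> C"
  shows "subset_mean p (insert c C) f = p * subset_mean p C (\<lambda>F. f (insert c F)) + (1 - p) * subset_mean p C f"
proof -
  have "inj_on (insert c) (Pow C)"
    using assms by (auto simp: inj_on_def)
  moreover have "card (insert c F) = Suc (card F)" "insert c C - insert c F = C - F"
      "card (insert c C - F) = Suc (card (C - F))" if "F \<subseteq> C" for F
  proof -
    have "finite F" "c \<notin> F" using that assms finite_subset by auto
    then show "card (insert c F) = Suc (card F)" by simp
    show "insert c C - insert c F = C - F" using assms by auto
    have "insert c C - F = insert c (C - F)" using \<open>c \<notin> F\<close> by auto
    then show "card (insert c C - F) = Suc (card (C - F))" using assms by simp
  qed
  moreover have "Pow (insert c C) = Pow C \<union> insert c ` Pow C" "Pow C \<inter> insert c ` Pow C = {}"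
    using assms by (auto simp: Pow_insert)
  ultimately show ?thesis
    using assms
    by (simp add: subset_mean_def sum.union_disjoint sum.reindex sum_distrib_left algebra_simps)
qed

lemma subset_mean_cong: "(\<And>F. F \<subseteq> C \<Longrightarrow> f F = g F) \<Longrightarrow> subset_mean p C f = subset_mean p C g"
  by (auto simp: subset_mean_def intro!: sum.cong)

lemma subset_mean_const [simp]: "finite C \<Longrightarrow> subset_mean p C (\<lambda>_. k) = k"
  by (induction rule: finite_induct) (auto simp: subset_mean_insert algebra_simps)

lemma subset_mean_Un:
  assumes "finite C" "finite D" "C \<inter> D = {}"
  shows "subset_mean p (C \<union> D) f = subset_mean p C (\<lambda>F. subset_mean p D (\<lambda>G. f (F \<union> G)))"
  using assms
  by (induction arbitrary: f rule: finite_induct) (auto simp: subset_mean_insert)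

lemma subset_mean_image:
  assumes "finite C" "inj_on g C"
  shows "subset_mean p (g ` C) f = subset_mean p C (\<lambda>F. f (g ` F))"
  using assms
  by (induction arbitrary: f rule: finite_induct) (auto simp: subset_mean_insert)

lemma prob_random_subset:
  assumes "finite C" "0 \<le> p" "p \<le> 1"
  shows "measure_pmf.prob (map_pmf (\<lambda>f. {c \<in> C. f c}) (Pi_pmf C False (\<lambda>_. bernoulli_pmf p))) S
    = subset_mean p C (\<lambda>F. if F \<in> S then 1 else 0)"
  using assms(1)
proof (induction arbitrary: S rule: finite_induct)
  case empty
  then show ?case by (simp add: indicator_def)
next
  case (insert x C)
  define Q where "Q = Pi_pmf C False (\<lambda>_. bernoulli_pmf p)"
  let ?g = "\<lambda>f. {c \<in> C. f c}"
  have *: "map_pmf (\<lambda>f. {c \<in> insert x C. f c}) (Pi_pmf (insert x C) False (\<lambda>_. bernoulli_pmf p))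
      = bernoulli_pmf p \<bind> (\<lambda>y. map_pmf (\<lambda>F. if y then insert x F else F) (map_pmf ?g Q))"
    unfolding Pi_pmf_insert[OF insert(1,2)] Q_def[symmetric] pair_pmf_def map_bind_pmf
      bind_return_pmf map_pmf_comp map_return_pmf
    unfolding map_pmf_def[symmetric] map_pmf_comp
    using insert(2) by (intro bind_pmf_cong map_pmf_cong refl) auto
  have "measure_pmf.prob (bernoulli_pmf p \<bind>
          (\<lambda>y. map_pmf (\<lambda>F. if y then insert x F else F) (map_pmf ?g Q))) S
      = p * measure_pmf.prob (map_pmf ?g Q) {F. insert x F \<in> S}
      + (1 - p) * measure_pmf.prob (map_pmf ?g Q) S"
  proof -
    have "emeasure (measure_pmf (bernoulli_pmf p \<bind>
          (\<lambda>y. map_pmf (\<lambda>F. if y then insert x F else F) (map_pmf ?g Q)))) S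
      = ennreal p * emeasure (measure_pmf (map_pmf ?g Q)) {F. insert x F \<in> S}
        + ennreal (1 - p) * emeasure (measure_pmf (map_pmf ?g Q)) S"
      using assms(2,3) by (simp add: vimage_def mult.commute)
    then show ?thesis
      using assms(2,3)
      unfolding measure_pmf.emeasure_eq_measure
      by (simp add: ennreal_mult[symmetric] ennreal_plus[symmetric] del: ennreal_plus)
  qed
  also have "\<dots> = subset_mean p (insert x C) (\<lambda>F. if F \<in> S then 1 else 0)"
    unfolding Q_def insert.IH using insert by (simp add: subset_mean_insert)
  finally show ?case unfolding * .
qed

text \<open>For \<open>b + c = 1\<close> this is the expectation of \<open>f\<close> under the binomial distribution with parameters
  \<open>m\<close> and \<open>c\<close>; with \<open>b + c < 1\<close> the missing mass is that of variables reached in both signs.\<close>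

primrec bsum :: "nat \<Rightarrow> real \<Rightarrow> real \<Rightarrow> (nat \<Rightarrow> real) \<Rightarrow> real" where
  "bsum 0 b c f = f 0"
| "bsum (Suc m) b c f = b * bsum m b c f + c * bsum m b c (\<lambda>k. f (Suc k))"

text \<open>\<open>noconf p v a\<close>: probability that propagation from \<open>a\<close> active literals never meets a
  contradiction when \<open>v\<close> variables remain, those of the active literals included.\<close>

primrec noconf :: "real \<Rightarrow> nat \<Rightarrow> nat \<Rightarrow> real" where
  "noconf p 0 a = 1"
| "noconf p (Suc v) a = (if a = 0 then 1 else
     (1 - p) ^ (a - 1) * bsum (Suc v - a) ((1 - p)\<^sup>2) (2 * p * (1 - p)) (\<lambda>k. noconf p v (a - 1 + k)))"

text \<open>The variables contribute independent factors. One that already carries an active literal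
  must not receive the opposite sign, which costs 1 - p. Any other one receives no literal, weight
  (1 - p)^2, or exactly one, weight 2 p (1 - p); both would be a contradiction. The bound on
  \<open>card A\<close> is carried along so that the truncated subtraction is a true one in the
  induction.\<close>

lemma subset_mean_consistent:
  assumes "finite V" "A \<subseteq> lits V" "consistent A"
  shows "subset_mean p (lits V) (\<lambda>N. if consistent (A \<union> N) then f (card (A \<union> N)) else 0)
    = (1 - p) ^ card A * bsum (card V - card A) ((1 - p)\<^sup>2) (2 * p * (1 - p)) (\<lambda>k. f (card A + k))
      \<and> card A \<le> card V"
  using assms
proof (induction arbitrary: A f rule: finite_induct)
  case empty
  then show ?case by simp
next
  case (insert w V)
  have fin: "finite (lits V)" "finite (insert (Neg w) (lits V))"
    using insert by (auto simp: finite_lits)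
  have nin: "Pos w \<notin> insert (Neg w) (lits V)" "Neg w \<notin> lits V"
    using insert by (auto simp: lits_def)
  have finA: "finite A"
    using insert finite_lits[of "insert w V"] by (auto intro: finite_subset)
  show ?case
  proof (cases "Pos w \<in> A \<or> Neg w \<in> A")
    case False
    then have AV: "A \<subseteq> lits V"
      using insert by (auto simp: lits_insert)
    have c1: "consistent (A \<union> insert l N) \<longleftrightarrow> consistent (A \<union> N)"
        "card (A \<union> insert l N) = Suc (card (A \<union> N))"
      if "N \<subseteq> lits V" "var l = w" for N l
    proof -
      have l: "u \<noteq> l" "u \<noteq> negate l" "negate u \<noteq> l" if "u \<in> A \<union> N" for u
        using that AV \<open>N \<subseteq> lits V\<close> \<open>var l = w\<close> insert(2) by (auto simp: lits_def)
      then show "consistent (A \<union> insert l N) \<longleftrightarrow> consistent (A \<union> N)"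
        by (auto simp: consistent_def)
      have "finite (A \<union> N)" using finA fin that finite_subset by auto
      moreover have "l \<notin> A \<union> N" using l by blast
      ultimately show "card (A \<union> insert l N) = Suc (card (A \<union> N))" by simp
    qed
    have c2: "\<not> consistent (A \<union> insert (Pos w) (insert (Neg w) N))" for N
      by (auto simp: consistent_def)
    have "subset_mean p (lits (insert w V)) (\<lambda>N. if consistent (A \<union> N) then f (card (A \<union> N)) else 0)
      = (1 - p)\<^sup>2 * subset_mean p (lits V) (\<lambda>N. if consistent (A \<union> N) then f (card (A \<union> N)) else 0)
      + 2 * p * (1 - p) * subset_mean p (lits V) (\<lambda>N. if consistent (A \<union> N) then f (Suc (card (A \<union> N))) else 0)"
      (is "_ = _ * ?E1 + _ * ?E2")
    proof -
      have "subset_mean p (lits V) (\<lambda>N. if consistent (A \<union> insert l N) then f (card (A \<union> insert l N)) else 0) = ?E2"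
        if "var l = w" for l
        by (rule subset_mean_cong) (simp only: c1[OF _ that])
      from this[of "Pos w"] this[of "Neg w"] show ?thesis
        by (simp only: lits_insert subset_mean_insert fin nin c2 if_False subset_mean_const not_False_eq_True var.simps)
           (simp add: algebra_simps power2_eq_square)
    qed
    moreover have "card (insert w V) - card A = Suc (card V - card A)"
      using insert.IH[OF AV insert.prems(2), of f] insert(1,2) by (simp add: Suc_diff_le)
    ultimately show ?thesis
      using insert.IH[OF AV insert.prems(2), of f] insert.IH[OF AV insert.prems(2), of "\<lambda>k. f (Suc k)"]
        insert(1,2)
      by (simp add: algebra_simps)
  next
    case True
    then obtain l where l: "l \<in> A" "var l = w" by auto
    define B where "B = A - {l}"
    have B: "B \<subseteq> lits V" "consistent B" "A = insert l B" "l \<notin> B" "finite B"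
    proof -
      have "var u \<in> V" if "u \<in> A" "u \<noteq> l" for u
      proof -
        have "u \<noteq> negate l" using that l insert.prems(2) by (auto simp: consistent_def)
        then have "var u \<noteq> w" using that l by (auto simp: var_eq_iff)
        then show ?thesis using that insert.prems(1) by (auto simp: lits_def)
      qed
      then show "B \<subseteq> lits V" by (auto simp: B_def lits_def)
      show "consistent B"
        using insert.prems(2) by (rule consistent_subset) (auto simp: B_def)
    qed (use l finA in \<open>auto simp: B_def\<close>)
    have lits: "lits (insert w V) = insert l (insert (negate l) (lits V))"
      using l by (cases l) (auto simp: lits_insert)
    have nin': "l \<notin> insert (negate l) (lits V)" "negate l \<notin> lits V"
      using l insert by (auto simp: lits_def)
    have c1: "consistent (A \<union> N) \<longleftrightarrow> consistent (B \<union> N)"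
        "card (A \<union> N) = Suc (card (B \<union> N))" if "N \<subseteq> lits V" for N
    proof -
      have l: "u \<noteq> l" "u \<noteq> negate l" "negate u \<noteq> l" if "u \<in> B \<union> N" for u
        using that B \<open>N \<subseteq> lits V\<close> \<open>var l = w\<close> insert(2) by (auto simp: lits_def)
      then show "consistent (A \<union> N) \<longleftrightarrow> consistent (B \<union> N)"
        by (auto simp: consistent_def B(3))
      have "finite (B \<union> N)" using B fin that finite_subset by auto
      moreover have "l \<notin> B \<union> N" using l by blast
      ultimately show "card (A \<union> N) = Suc (card (B \<union> N))" by (simp add: B(3))
    qed
    have c2: "\<not> consistent (A \<union> insert (negate l) N)" "\<not> consistent (A \<union> insert l (insert (negate l) N))" for N
      using l by (auto simp: consistent_def)
    \<comment> \<open>Drawing \<open>l\<close> again changes nothing, so its two weights add up to 1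
      and only the absence of \<open>negate l\<close> costs a factor.\<close>
    have c3: "A \<union> insert l N = A \<union> N" for N using l by auto
    have fin': "finite (insert (negate l) (lits V))" using fin by simp
    have "subset_mean p (lits (insert w V)) (\<lambda>N. if consistent (A \<union> N) then f (card (A \<union> N)) else 0)
      = (1 - p) * subset_mean p (lits V) (\<lambda>N. if consistent (A \<union> N) then f (card (A \<union> N)) else 0)"
      by (simp only: lits subset_mean_insert fin fin' nin' c2 if_False subset_mean_const not_False_eq_True c3)
         (simp add: algebra_simps)
    also have "subset_mean p (lits V) (\<lambda>N. if consistent (A \<union> N) then f (card (A \<union> N)) else 0)
      = subset_mean p (lits V) (\<lambda>N. if consistent (B \<union> N) then f (Suc (card (B \<union> N))) else 0)"
      by (rule subset_mean_cong) (simp only: c1)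
    finally show ?thesis
      using insert.IH[OF B(1,2), of "\<lambda>k. f (Suc k)"] insert(1,2) B(3-5)
      by simp
  qed
qed

text \<open>Splitting the clauses by an active literal \<open>y\<close>: those with
  \<open>negate y\<close> determine the new literals, those with \<open>y\<close> do not affect the
  event and average out, and the rest is an independent fresh formula on the remaining variables.
  Any choice of \<open>y\<close> gives the same value, because only cardinalities enter.\<close>

lemma subset_mean_consistent_reach_set:
  assumes "finite V" "A \<subseteq> lits V" "consistent A"
  shows "subset_mean p (clauses_on V) (\<lambda>F. if consistent (reach_set F A) then 1 else 0) = noconf p (card V) (card A)"
  using assms
proof (induction "card V" arbitrary: V A)
  case 0
  then have "V = {}" "A = {}" by auto
  then show ?case by (simp add: clauses_on_def reach_set_def consistent_def)
next
  case (Suc v)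
  have finA: "finite A" using Suc finite_lits finite_subset by blast
  have finC: "finite (clauses_on V)" using Suc finite_clauses_on by blast
  show ?case
  proof (cases "A = {}")
    case True
    then have "consistent (reach_set F A)" for F by (simp add: reach_set_def consistent_def)
    then show ?thesis using True finC unfolding Suc(2)[symmetric] by simp
  next
    case False
    then obtain y where y: "y \<in> A" by auto
    define V' where "V' = V - {var y}"
    define A' where "A' = A - {y}"
    have yV: "var y \<in> V" using y Suc by (auto simp: lits_def)
    have V': "finite V'" "card V' = v" "var y \<notin> V'" "V = insert (var y) V'"
      using Suc yV by (auto simp: V'_def)
    have A': "A' \<subseteq> lits V'" "consistent A'" "card A = Suc (card A')"
      using Suc y finA
      by (auto simp: A'_def V'_def lits_def consistent_def var_eq_iff)
         (metis Suc_pred card_gt_0_iff empty_iff)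
    define h where "h u z = {u, z}" for u z :: literal
    have ynot: "y \<notin> lits V'" "negate y \<notin> lits V'" using V' by (auto simp: lits_def)
    have V'y: "u \<noteq> y" "u \<noteq> negate y" "negate u \<noteq> y" if "u \<in> lits V'" for u
      using that ynot by auto
    have decomp: "clauses_on V = h (negate y) ` lits V' \<union> (h y ` lits V' \<union> clauses_on V')"
    proof (rule set_eqI)
      fix c
      have litsV: "lits V = insert y (insert (negate y) (lits V'))"
        unfolding V'(4) lits_insert by (cases y) auto
      show "c \<in> clauses_on V \<longleftrightarrow> c \<in> h (negate y) ` lits V' \<union> (h y ` lits V' \<union> clauses_on V')"
      proof
        assume "c \<in> clauses_on V"
        then obtain u v where "c = {u, v}" "u \<in> lits V" "v \<in> lits V" "u \<noteq> v" "u \<noteq> negate v"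
          by (auto simp: clauses_on_def)
        then show "c \<in> h (negate y) ` lits V' \<union> (h y ` lits V' \<union> clauses_on V')"
          unfolding litsV by (auto simp: h_def pair_in_clauses_on image_iff insert_commute)
      next
        assume "c \<in> h (negate y) ` lits V' \<union> (h y ` lits V' \<union> clauses_on V')"
        then consider z where "z \<in> lits V'" "c = {negate y, z}" | z where "z \<in> lits V'" "c = {y, z}"
          | "c \<in> clauses_on V'"
          unfolding h_def by blast
        then show "c \<in> clauses_on V"
        proof cases
          case (1 z)
          then show ?thesis
            using V'y(1,2)[OF 1(1)] unfolding 1(2) pair_in_clauses_on litsV by auto
        next
          case (2 z)
          then show ?thesis
            using V'y[OF 2(1)] unfolding 2(2) pair_in_clauses_on litsV by auto
        next
          case 3
          then obtain u v where "c = {u, v}" "u \<in> lits V'" "v \<in> lits V'" "u \<noteq> v" "u \<noteq> negate v"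
            unfolding clauses_on_def by blast
          then show ?thesis by (simp add: pair_in_clauses_on litsV)
        qed
      qed
    qed
    have no_y: "y \<notin> c \<and> negate y \<notin> c" if "c \<in> clauses_on V'" for c
    proof -
      obtain u v where "c = {u, v}" "u \<in> lits V'" "v \<in> lits V'"
        using \<open>c \<in> clauses_on V'\<close> unfolding clauses_on_def by blast
      then show ?thesis using ynot by auto
    qed
    have disj: "h (negate y) ` lits V' \<inter> (h y ` lits V' \<union> clauses_on V') = {}"
        "h y ` lits V' \<inter> clauses_on V' = {}"
    proof -
      have "h (negate y) z \<noteq> h y z'" if "z \<in> lits V'" "z' \<in> lits V'" for z z'
        using V'y[OF that(1)] V'y[OF that(2)] by (auto simp: h_def doubleton_eq_iff)
      moreover have "h (negate y) z \<notin> clauses_on V'" "h y z \<notin> clauses_on V'" for z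
        using no_y[of "h (negate y) z"] no_y[of "h y z"] by (auto simp: h_def)
      ultimately show "h (negate y) ` lits V' \<inter> (h y ` lits V' \<union> clauses_on V') = {}"
        "h y ` lits V' \<inter> clauses_on V' = {}" by blast+
    qed
    have inj: "inj_on (h u) X" for u X
      by (auto simp: inj_on_def h_def doubleton_eq_iff)
    note fin = finite_lits[OF V'(1)] finite_clauses_on[OF V'(1)]
    have step: "consistent (reach_set (h (negate y) ` N \<union> (h y ` M \<union> G)) A)
        \<longleftrightarrow> consistent (reach_set G (A' \<union> N))"
      if "N \<subseteq> lits V'" "M \<subseteq> lits V'" "G \<subseteq> clauses_on V'" for N M G
    proof -
      let ?F = "h (negate y) ` N \<union> (h y ` M \<union> G)"
      have "?F \<subseteq> clauses_on V"
        unfolding decomp using that by auto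
      note unit_propagation_step[OF this Suc(5,4) y]
      moreover have "?F \<inter> clauses_on (V - {var y}) = G"
        using that disj unfolding V'_def[symmetric] by fast
      moreover have "{z. {negate y, z} \<in> ?F} = N"
      proof -
        have "{negate y, z} \<notin> G" for z
          using no_y[of "{negate y, z}"] that(3) by auto
        moreover have "{negate y, z} \<notin> h y ` M" for z
        proof
          assume "{negate y, z} \<in> h y ` M"
          then obtain z' where "z' \<in> M" "{negate y, z} = {y, z'}" by (auto simp: h_def)
          moreover have "z' \<noteq> negate y" using V'y(2) that(2) \<open>z' \<in> M\<close> by auto
          ultimately show False by (auto simp: doubleton_eq_iff)
        qed
        moreover have "{negate y, z} \<in> h (negate y) ` N \<longleftrightarrow> z \<in> N" for z
          using that V'y by (auto simp: h_def doubleton_eq_iff)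
        ultimately show ?thesis by blast
      qed
      ultimately show ?thesis by (simp add: A'_def)
    qed
    have "subset_mean p (clauses_on V) (\<lambda>F. if consistent (reach_set F A) then 1 else 0)
       = subset_mean p (lits V') (\<lambda>N. subset_mean p (lits V') (\<lambda>M. subset_mean p (clauses_on V')
            (\<lambda>G. if consistent (reach_set (h (negate y) ` N \<union> (h y ` M \<union> G)) A) then 1 else 0)))"
      unfolding decomp using fin disj inj
      by (simp add: subset_mean_Un subset_mean_image)
    also have "\<dots> = subset_mean p (lits V') (\<lambda>N. subset_mean p (lits V') (\<lambda>M. subset_mean p (clauses_on V')
            (\<lambda>G. if consistent (reach_set G (A' \<union> N)) then 1 else 0)))"
      by (intro subset_mean_cong) (simp only: step)
    also have "\<dots> = subset_mean p (lits V') (\<lambda>N. subset_mean p (clauses_on V')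
            (\<lambda>G. if consistent (reach_set G (A' \<union> N)) then 1 else 0))"
      using fin by simp
    also have "\<dots> = subset_mean p (lits V') (\<lambda>N. if consistent (A' \<union> N) then noconf p v (card (A' \<union> N)) else 0)"
    proof (rule subset_mean_cong)
      fix N assume N: "N \<subseteq> lits V'"
      show "subset_mean p (clauses_on V') (\<lambda>G. if consistent (reach_set G (A' \<union> N)) then 1 else 0)
         = (if consistent (A' \<union> N) then noconf p v (card (A' \<union> N)) else 0)"
      proof (cases "consistent (A' \<union> N)")
        case True
        then show ?thesis using Suc(1)[of V' "A' \<union> N"] V' A' N by simp
      next
        case False
        then have "\<not> consistent (reach_set G (A' \<union> N))" for G
          using consistent_subset subset_reach_set by blast
        then show ?thesis using False fin by simp
      qed
    qed
    also have "\<dots> = noconf p (Suc v) (card A)"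
      using subset_mean_consistent[OF V'(1) A'(1,2), of p "noconf p v"] A'(3) V'(2) by simp
    finally show ?thesis using Suc(2) by simp
  qed
qed

lemma reach_prob_eq:
  assumes "0 \<le> p" "p \<le> 1" "x \<in> literals n"
  shows "reach_prob n p x = 1 - noconf p n 1"
proof -
  have fin: "finite (clauses n)" by (simp add: clauses_eq finite_clauses_on)
  have "measure_pmf.prob (random_formula n p) (- {F. reaches F x (negate x)}) = noconf p n 1"
  proof -
    have "measure_pmf.prob (random_formula n p) (- {F. reaches F x (negate x)})
      = subset_mean p (clauses n) (\<lambda>F. if consistent (reach_set F {x}) then 1 else 0)"
      unfolding random_formula_def prob_random_subset[OF fin assms(1,2)]
      by (simp add: reaches_negate_iff)
    also have "\<dots> = noconf p n 1"
      unfolding clauses_eq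
      using subset_mean_consistent_reach_set[of "{1..n}" "{x}" p] assms(3)
      by (simp add: clauses_eq consistent_def)
    finally show ?thesis .
  qed
  then show ?thesis
    using measure_pmf.prob_compl[of "{F. reaches F x (negate x)}" "random_formula n p"]
    by (simp add: reach_prob_def Compl_eq_Diff_UNIV)
qed

section \<open>Moments and tilting of binomial sums\<close>

lemma bsum_mono:
  "0 \<le> b \<Longrightarrow> 0 \<le> c \<Longrightarrow> (\<And>k. k \<le> m \<Longrightarrow> f k \<le> g k) \<Longrightarrow> bsum m b c f \<le> bsum m b c g"
  by (induction m arbitrary: f g) (auto intro!: add_mono mult_left_mono)

lemma bsum_cong: "(\<And>k. k \<le> m \<Longrightarrow> f k = g k) \<Longrightarrow> bsum m b c f = bsum m b c g"
proof (induction m arbitrary: f g)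
  case (Suc m)
  have "bsum m b c f = bsum m b c g" "bsum m b c (\<lambda>k. f (Suc k)) = bsum m b c (\<lambda>k. g (Suc k))"
    using Suc.prems by (intro Suc.IH; simp)+
  then show ?case by simp
qed simp

lemma bsum_add: "bsum m b c (\<lambda>k. f k + g k) = bsum m b c f + bsum m b c g"
  by (induction m arbitrary: f g) (auto simp: algebra_simps)

lemma bsum_diff: "bsum m b c (\<lambda>k. f k - g k) = bsum m b c f - bsum m b c g"
  using bsum_add[of m b c "\<lambda>k. f k - g k" g] by simp

lemma bsum_cmult: "bsum m b c (\<lambda>k. r * f k) = r * bsum m b c f"
  by (induction m arbitrary: f) (auto simp: algebra_simps)

text \<open>Exponential tilting: a weight \<open>z ^ k\<close> is absorbed into the parameter
  \<open>c\<close>. Together with \<open>bsum_normalize\<close>, which restores total mass 1 at the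
  price of a factor \<open>t ^ m\<close>, it reduces all comparison functions below to binomial
  moments and powers.\<close>

lemma bsum_power_mult: "bsum m b c (\<lambda>k. z ^ k * f k) = bsum m b (c * z) f"
proof (induction m arbitrary: f)
  case (Suc m)
  have "bsum m b c (\<lambda>k. z ^ Suc k * f (Suc k)) = z * bsum m b c (\<lambda>k. z ^ k * f (Suc k))"
    by (simp add: bsum_cmult[symmetric] mult.assoc)
  then show ?case using Suc by simp
qed simp

lemma bsum_const: "bsum m b c (\<lambda>k. r) = r * (b + c) ^ m"
  by (induction m) (auto simp: algebra_simps)

lemma bsum_power: "bsum m b c (\<lambda>k. z ^ k) = (b + c * z) ^ m"
  using bsum_power_mult[of m b c z "\<lambda>_. 1"] by (simp add: bsum_const)

lemma bsum_normalize: "bsum m (t * b) (t * c) f = t ^ m * bsum m b c f"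
  by (induction m arbitrary: f) (auto simp: algebra_simps)

lemma bsum_quadratic:
  "bsum m (1 - c) c (\<lambda>k. u + v * real k + w * (real k)\<^sup>2)
     = u + v * (m * c) + w * ((m * c)\<^sup>2 + m * c * (1 - c))"
proof (induction m arbitrary: u v w)
  case (Suc m)
  have eq: "(\<lambda>k. u + v * real (Suc k) + w * (real (Suc k))\<^sup>2)
      = (\<lambda>k. (u + v + w) + (v + 2 * w) * real k + w * (real k)\<^sup>2)"
    by (auto simp: algebra_simps power2_eq_square)
  show ?case
    unfolding bsum.simps eq Suc by (simp add: algebra_simps power2_eq_square)
qed simp

lemma bsum_quadratic_shift:
  assumes "b + c = 1"
  shows "bsum m b c (\<lambda>k. u * real (a + k) + w * (real (a + k))\<^sup>2)
     = u * (a + m * c) + w * ((a + m * c)\<^sup>2 + m * c * (1 - c))"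
proof -
  have "(\<lambda>k. u * real (a + k) + w * (real (a + k))\<^sup>2)
      = (\<lambda>k. (u * a + w * (real a)\<^sup>2) + (u + 2 * w * a) * real k + w * (real k)\<^sup>2)"
    by (auto simp: algebra_simps power2_eq_square)
  moreover have "b = 1 - c" using assms by simp
  ultimately show ?thesis
    by (simp only: bsum_quadratic) (simp add: algebra_simps power2_eq_square)
qed

lemma noconf_Suc_Suc:
  "noconf p (Suc v) (Suc a)
     = (1 - p) ^ a * bsum (v - a) ((1 - p)\<^sup>2) (2 * p * (1 - p)) (\<lambda>k. noconf p v (a + k))"
  by simp

lemma noconf_0_right [simp]: "noconf p v 0 = 1"
  by (cases v) auto

lemma noconf_nonneg:
  assumes "0 \<le> p" "p \<le> 1"
  shows "0 \<le> noconf p v a"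
proof (induction v arbitrary: a)
  case (Suc v)
  have "0 \<le> bsum m ((1 - p)\<^sup>2) (2 * p * (1 - p)) (\<lambda>k. noconf p v (a' + k))" for m a'
    using bsum_mono[of "(1 - p)\<^sup>2" "2 * p * (1 - p)" m "\<lambda>_. 0" "\<lambda>k. noconf p v (a' + k)"] Suc assms
    by (simp add: bsum_const)
  then show ?case
    using assms by (cases a) (simp_all del: noconf.simps(2) add: noconf_Suc_Suc)
qed simp

lemma noconf_le_1:
  assumes "0 \<le> p" "p \<le> 1"
  shows "noconf p v a \<le> 1"
proof (induction v arbitrary: a)
  case (Suc v)
  show ?case
  proof (cases a)
    case (Suc j)
    have "bsum (v - j) ((1 - p)\<^sup>2) (2 * p * (1 - p)) (\<lambda>k. noconf p v (j + k))
        \<le> 1 * ((1 - p)\<^sup>2 + 2 * p * (1 - p)) ^ (v - j)"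
      unfolding bsum_const[symmetric] using Suc.IH assms by (intro bsum_mono) auto
    also have "(1 - p)\<^sup>2 + 2 * p * (1 - p) = 1 - p\<^sup>2"
      by (simp add: power2_eq_square algebra_simps)
    also have "1 * (1 - p\<^sup>2) ^ (v - j) \<le> 1"
      using assms by (simp add: power_le_one power2_eq_square mult_le_one)
    finally have "(1 - p) ^ j * bsum (v - j) ((1 - p)\<^sup>2) (2 * p * (1 - p)) (\<lambda>k. noconf p v (j + k))
        \<le> (1 - p) ^ j * 1"
      using assms by (intro mult_left_mono) auto
    also have "\<dots> \<le> 1" using assms by (simp add: power_le_one)
    finally show ?thesis unfolding Suc noconf_Suc_Suc .
  qed simp
qed simp

section \<open>Comparison with sub- and supersolutions\<close>

text \<open>A discrete comparison principle. \<open>W\<close> is indexed by the untouched variables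
  \<open>m\<close> instead of all remaining ones, so \<open>k\<close> new literals move (m, a) to (m
  - k, a + k). The inequality is required only where \<open>W\<close> is positive, since elsewhere
  nonnegativity of \<open>noconf\<close> settles the matter.\<close>

lemma noconf_ge_subsolution:
  fixes W :: "nat \<Rightarrow> nat \<Rightarrow> real"
  assumes p: "0 \<le> p" "p \<le> 1"
    and W0: "\<And>m. W m 0 \<le> 1"
    and step: "\<And>m a. m + a < n \<Longrightarrow> 0 < W m (Suc a) \<Longrightarrow> W m (Suc a)
      \<le> (1 - p) ^ a * bsum m ((1 - p)\<^sup>2) (2 * p * (1 - p)) (\<lambda>k. W (m - k) (a + k))"
  shows "a \<le> v \<Longrightarrow> v \<le> n \<Longrightarrow> W (v - a) a \<le> noconf p v a"
proof (induction v arbitrary: a)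
  case 0
  then show ?case using W0 by simp
next
  case (Suc v)
  show ?case
  proof (cases a)
    case 0
    then show ?thesis using W0 by simp
  next
    case (Suc j)
    show ?thesis
    proof (cases "0 < W (v - j) (Suc j)")
      case True
      have "W (v - j) (Suc j)
        \<le> (1 - p) ^ j * bsum (v - j) ((1 - p)\<^sup>2) (2 * p * (1 - p)) (\<lambda>k. W (v - j - k) (j + k))"
        using True Suc Suc.prems by (intro step) auto
      also have "\<dots> \<le> noconf p (Suc v) (Suc j)"
        unfolding noconf_Suc_Suc
      proof (intro mult_left_mono bsum_mono)
        fix k assume "k \<le> v - j"
        then show "W (v - j - k) (j + k) \<le> noconf p v (j + k)"
          using Suc.IH[of "j + k"] Suc Suc.prems by (simp add: diff_diff_left)
      qed (use p in auto)
      finally show ?thesis using Suc by simp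
    next
      case False
      then show ?thesis using noconf_nonneg[OF p, of "Suc v" "Suc j"] Suc by simp
    qed
  qed
qed

text \<open>The mirror image, with the trivial bound 1 in place of 0. Points where \<open>W\<close>
  is at least 1 are free, which lets the later functions ignore everything outside a chosen
  region.\<close>

lemma noconf_le_supersolution:
  fixes W :: "nat \<Rightarrow> nat \<Rightarrow> real"
  assumes p: "0 \<le> p" "p \<le> 1"
    and W0: "\<And>m. 1 \<le> W m 0"
    and step: "\<And>m a. m + a < n \<Longrightarrow> W m (Suc a) < 1 \<Longrightarrow>
      (1 - p) ^ a * bsum m ((1 - p)\<^sup>2) (2 * p * (1 - p)) (\<lambda>k. W (m - k) (a + k)) \<le> W m (Suc a)"
  shows "a \<le> v \<Longrightarrow> v \<le> n \<Longrightarrow> noconf p v a \<le> W (v - a) a"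
proof (induction v arbitrary: a)
  case 0
  then show ?case using W0 by simp
next
  case (Suc v)
  show ?case
  proof (cases a)
    case 0
    then show ?thesis using W0 by simp
  next
    case (Suc j)
    show ?thesis
    proof (cases "W (v - j) (Suc j) < 1")
      case True
      have "noconf p (Suc v) (Suc j)
        \<le> (1 - p) ^ j * bsum (v - j) ((1 - p)\<^sup>2) (2 * p * (1 - p)) (\<lambda>k. W (v - j - k) (j + k))"
        unfolding noconf_Suc_Suc
      proof (intro mult_left_mono bsum_mono)
        fix k assume "k \<le> v - j"
        then show "noconf p v (j + k) \<le> W (v - j - k) (j + k)"
          using Suc.IH[of "j + k"] Suc Suc.prems by (simp add: diff_diff_left)
      qed (use p in auto)
      also have "\<dots> \<le> W (v - j) (Suc j)"
        using True Suc Suc.prems by (intro step) auto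
      finally show ?thesis using Suc by simp
    next
      case False
      then show ?thesis using noconf_le_1[OF p, of "Suc v" "Suc j"] Suc by simp
    qed
  qed
qed

text \<open>\<open>r\<close> plays the role of an extinction probability and \<open>root\<close> is
  the inequality version of its fixed-point equation, relaxed by a factor 1 - p.
  \<open>drift\<close> says that the walk tilted by \<open>r\<close> has mean offspring at most 1 -
  d. Both are stated at \<open>n\<close>, the worst case: with fewer variables \<open>t ^ m\<close>
  is larger and the mean offspring smaller.\<close>

lemma noconf_ge:
  assumes p: "0 \<le> p" "p < 1" and r: "0 < r" "r \<le> 1" and d: "0 < d" "d \<le> 1" and n: "1 \<le> n"
    and t: "t = (1 - p)\<^sup>2 + 2 * p * (1 - p) * r"
    and root: "r * (1 - p) \<le> t ^ n"
    and drift: "n * (2 * p * (1 - p) * r) \<le> (1 - d) * t"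
  shows "r * (1 - p * (1 + d) / (2 * d\<^sup>2)) \<le> noconf p n 1"
proof -
  define b where "b = (1 - p)\<^sup>2"
  define c where "c = 2 * p * (1 - p)"
  \<comment> \<open>Chosen so that one step with drift -d lowers \<open>V\<close> by at least the
    killing p (a + 1): \<open>2 * c2 * d = p\<close> matches the linear part, and
    \<open>c1 * d = c2\<close> cancels the loss of at most \<open>c2\<close> from the
    variance.\<close>
  define c2 where "c2 = p / (2 * d)"
  define c1 where "c1 = c2 / d"
  define V where "V j = c1 * real j + c2 * (real j)\<^sup>2" for j :: nat
  \<comment> \<open>tilting by \<open>r\<close> gives the walk drift at most \<open>- d\<close>; then \<open>V\<close> is the expected killing until extinction\<close>
  define W where "W m a = r ^ a * (1 - V a)" for m a :: nat
  have cs: "0 \<le> c1" "0 \<le> c2" using p d by (auto simp: c1_def c2_def)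
  have bc: "0 < b" "0 \<le> c" "b + c = 1 - p\<^sup>2"
    using p by (auto simp: b_def c_def) (simp add: power2_eq_square algebra_simps)
  have t': "t = b + c * r" by (simp add: t b_def c_def)
  have tpos: "0 < t" using bc r by (auto simp: t' intro!: add_pos_nonneg)
  have "c * r \<le> c * 1" using bc r by (intro mult_left_mono) auto
  then have t1: "t \<le> 1" using bc by (simp add: t') (smt (verit) zero_le_power2)
  define q where "q = c * r / t"
  have q: "0 \<le> q" "b / t + q = 1" "n * q \<le> 1 - d"
  proof -
    show "0 \<le> q" using tpos bc r by (simp add: q_def)
    have "b / t + q = (b + c * r) / t" by (simp add: q_def add_divide_distrib)
    then show "b / t + q = 1" using tpos by (simp add: t'[symmetric])
    show "n * q \<le> 1 - d" using tpos drift by (simp add: q_def c_def divide_le_eq)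
  qed
  have step: "W m (Suc a) \<le> (1 - p) ^ a * bsum m b c (\<lambda>k. W (m - k) (a + k))"
    if "m + a < n" "0 < W m (Suc a)" for m a
  proof -
    define mu where "mu = m * q"
    define EV where "EV = c1 * (a + mu) + c2 * ((a + mu)\<^sup>2 + mu * (1 - q))"
    have q1: "q \<le> 1" using q(2) bc tpos divide_pos_pos[of b t] by linarith
    have mu: "0 \<le> mu" "mu \<le> 1 - d"
    proof -
      show "0 \<le> mu" using q by (simp add: mu_def)
      have "m * q \<le> n * q" using that q by (intro mult_right_mono) auto
      then show "mu \<le> 1 - d" using q by (simp add: mu_def)
    qed
    have "bsum m b c (\<lambda>k. W (m - k) (a + k)) = r ^ a * bsum m b (c * r) (\<lambda>k. 1 - V (a + k))"
      unfolding bsum_power_mult[symmetric] bsum_cmult[symmetric]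
      by (simp add: W_def power_add mult.assoc)
    also have "bsum m b (c * r) (\<lambda>k. 1 - V (a + k)) = t ^ m * bsum m (b / t) q (\<lambda>k. 1 - V (a + k))"
      unfolding bsum_normalize[symmetric] using tpos by (simp add: q_def)
    also have "bsum m (b / t) q (\<lambda>k. 1 - V (a + k)) = 1 - EV"
      unfolding bsum_diff bsum_const V_def bsum_quadratic_shift[OF q(2)] EV_def mu_def q(2) by simp
    finally have eq: "bsum m b c (\<lambda>k. W (m - k) (a + k)) = r ^ a * (t ^ m * (1 - EV))" .
    have "0 < 1 - V (Suc a)"
      using zero_less_mult_pos[of "r ^ Suc a" "1 - V (Suc a)"] that r by (simp add: W_def)
    have EV0: "0 \<le> EV" using cs mu q1 by (auto simp: EV_def)
    have VE: "p * Suc a \<le> V (Suc a) - EV"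
    proof -
      define D where "D = 1 - mu"
      have D: "d \<le> D" "D \<le> 1" using mu by (auto simp: D_def)
      have "V (Suc a) - EV = c1 * D + c2 * (2 * Suc a * D - D\<^sup>2 - mu * (1 - q))"
        by (simp add: V_def EV_def D_def algebra_simps power2_eq_square)
      moreover have "D\<^sup>2 + mu * (1 - q) \<le> 1"
      proof -
        have "D\<^sup>2 \<le> D" using D d by (simp add: power2_eq_square mult_left_le)
        moreover have "mu * (1 - q) \<le> mu" using mu q by (simp add: mult_left_le)
        ultimately show ?thesis by (simp add: D_def)
      qed
      then have "c2 * (2 * Suc a * D - 1) \<le> c2 * (2 * Suc a * D - D\<^sup>2 - mu * (1 - q))"
        using cs by (intro mult_left_mono) auto
      moreover have "c2 * (2 * Suc a * d - 1) \<le> c2 * (2 * Suc a * D - 1)"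
        using cs D by (intro mult_left_mono) auto
      moreover have "c1 * d \<le> c1 * D" using cs D by (intro mult_left_mono) auto
      moreover have "c1 * d = c2" "c2 * (2 * Suc a * d) = p * Suc a"
        using d by (simp_all add: c1_def c2_def)
      ultimately show ?thesis by (simp add: algebra_simps)
    qed
    have "0 \<le> p * Suc a" using p by simp
    then have EV1: "0 \<le> 1 - EV" using VE \<open>0 < 1 - V (Suc a)\<close> by linarith
    have tm: "r * (1 - p) \<le> t ^ m"
    proof -
      have "t ^ n \<le> t ^ m" using tpos t1 that by (intro power_decreasing) auto
      with root show ?thesis by linarith
    qed
    \<comment> \<open>The bookkeeping spends 1 - p once per active literal, that is
      \<open>Suc a\<close> times, while the recursion supplies only \<open>a\<close> factors. The
      missing one is the slack in \<open>root\<close>.\<close>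
    have "1 - V (Suc a) \<le> (1 - EV) - p * Suc a * 1" using VE by simp
    also have "\<dots> \<le> (1 - EV) - p * Suc a * (1 - EV)"
      using EV0 \<open>0 \<le> p * Suc a\<close> by (intro diff_left_mono mult_left_mono) auto
    also have "\<dots> = (1 + Suc a * (- p)) * (1 - EV)" by (simp add: algebra_simps)
    also have "\<dots> \<le> (1 + (- p)) ^ Suc a * (1 - EV)"
      using Bernoulli_inequality[of "- p" "Suc a"] p EV1 by (intro mult_right_mono) auto
    finally have "r ^ Suc a * (1 - V (Suc a)) \<le> r ^ Suc a * ((1 - p) ^ Suc a * (1 - EV))"
      using r by (intro mult_left_mono) auto
    also have "\<dots> = (1 - p) ^ a * (r ^ a * (r * (1 - p) * (1 - EV)))"
      by (simp add: algebra_simps)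
    also have "\<dots> \<le> (1 - p) ^ a * (r ^ a * (t ^ m * (1 - EV)))"
      using p r EV1 tm by (intro mult_left_mono mult_right_mono) auto
    finally show ?thesis unfolding eq by (simp add: W_def)
  qed
  have "W (n - 1) 1 \<le> noconf p n 1"
  proof (rule noconf_ge_subsolution[where n = n])
    show "W m 0 \<le> 1" for m by (simp add: W_def V_def)
  qed (use step p n in \<open>auto simp: b_def c_def\<close>)
  moreover have "W (n - 1) 1 = r * (1 - p * (1 + d) / (2 * d\<^sup>2))"
    using d by (simp add: W_def V_def c1_def c2_def field_simps power2_eq_square)
  ultimately show ?thesis by simp
qed

section \<open>Lower bound for contradictions below the threshold\<close>

lemma exp_neg_le:
  fixes y :: real
  assumes "0 \<le> y"
  shows "exp (- y) \<le> 1 - y + y\<^sup>2"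
proof -
  have "1 \<le> (1 + y) * (1 - y + y\<^sup>2)"
    using assms by (simp add: algebra_simps power2_eq_square power3_eq_cube)
  also have "\<dots> \<le> exp y * (1 - y + y\<^sup>2)"
  proof (intro mult_right_mono exp_ge_add_one_self)
    show "0 \<le> 1 - y + y\<^sup>2"
      using sum_squares_ge_zero[of "y - 1" y] assms by (simp add: power2_eq_square algebra_simps)
  qed
  finally show ?thesis by (simp add: exp_minus field_simps)
qed

lemma power_one_minus_le_exp:
  fixes p :: real
  assumes "0 \<le> p" "p \<le> 1"
  shows "(1 - p) ^ a \<le> exp (- (p * a))"
proof -
  have "(1 - p) ^ a \<le> exp (- p) ^ a"
    using assms exp_ge_add_one_self[of "- p"] by (intro power_mono) auto
  then show ?thesis by (simp add: exp_of_nat_mult[symmetric] mult.commute)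
qed

lemma power_le_exp_mult:
  fixes y :: real
  assumes "0 \<le> 1 + y"
  shows "(1 + y) ^ m \<le> exp (m * y)"
  using power_mono[OF exp_ge_add_one_self[of y] assms, of m]
  by (simp add: exp_of_nat_mult[symmetric])

text \<open>Here \<delta> is the tolerated relative loss of drift through depletion, \<eta> bounds
  the killing and the penalty in a single step, and x / e is the height up to which the walk is
  followed. The leading factor p / (2 e^2) is the one that \<open>noconf_ge\<close> produces for r =
  1 and d = e.\<close>

lemma noconf_le_subcritical:
  fixes e \<delta> \<eta> x p :: real
  assumes e: "0 < e" "e \<le> 1 / 100" and \<delta>: "0 < \<delta>" "\<delta> \<le> 1 / 8" and \<eta>: "0 < \<eta>" "\<eta> \<le> 1"
    and x: "1 \<le> x" and n: "1 \<le> n" and p: "p = (1 - e) / (2 * real n)"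
    and L: "2 * x\<^sup>2 / (\<delta> * \<eta>) \<le> n * e ^ 3"
    and e': "e' = e * (1 + 2 * \<delta>)"
  shows "noconf p n 1 \<le> 1 - p / (2 * e\<^sup>2) *
    ((1 - \<eta>)\<^sup>2 * (1 - 4 * e') / (1 + 2 * \<delta>)\<^sup>2 - 128 * exp (- x / 8))"
proof -
  have n0: "0 < real n" using n by simp
  have Lx: "2 * x\<^sup>2 \<le> \<delta> * \<eta> * (n * e ^ 3)"
    using L \<delta> \<eta> by (simp add: field_simps)
  have Lpos: "0 < n * e ^ 3" using n e by simp
  have xx: "x \<le> x\<^sup>2" "1 \<le> x\<^sup>2" using x by (auto simp: power2_eq_square intro: mult_left_le order_trans)
  have L\<delta>: "2 * x\<^sup>2 \<le> \<delta> * (n * e ^ 3)"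
  proof -
    have "\<delta> * \<eta> * (n * e ^ 3) \<le> \<delta> * 1 * (n * e ^ 3)"
      using \<delta> \<eta> Lpos by (intro mult_right_mono mult_left_mono) auto
    with Lx show ?thesis by simp
  qed
  have L\<eta>: "16 * x\<^sup>2 \<le> \<eta> * (n * e ^ 3)"
  proof -
    have "\<delta> * \<eta> * (n * e ^ 3) \<le> 1 / 8 * \<eta> * (n * e ^ 3)"
      using \<delta> \<eta> Lpos by (intro mult_right_mono) auto
    with Lx show ?thesis by simp
  qed
  have p0: "0 < p" using e n0 by (simp add: p)
  have np: "2 * (n * p) = 1 - e" using n0 by (simp add: p)
  have pn: "p \<le> 1 / (2 * n)" using e n0 by (simp add: p divide_right_mono)
  have p1: "p \<le> 1 / 2"
  proof -
    have "1 / (2 * real n) \<le> 1 / 2" using n by (intro divide_left_mono) auto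
    then show ?thesis using pn by simp
  qed
  have pL: "2 * p * (n * e ^ 3) \<le> e ^ 3"
    using pn n0 e by (simp add: field_simps)
  have p\<delta>: "p \<le> \<delta> * e"
  proof -
    have "4 * p * 1 \<le> 2 * p * (2 * x\<^sup>2)" using xx p0 by (simp add: mult_left_mono)
    also have "\<dots> \<le> 2 * p * (\<delta> * (n * e ^ 3))" using L\<delta> p0 by (intro mult_left_mono) auto
    also have "\<dots> = \<delta> * (2 * p * (n * e ^ 3))" by simp
    also have "\<dots> \<le> \<delta> * e ^ 3" using pL \<delta> by (intro mult_left_mono) auto
    also have "\<dots> \<le> \<delta> * e"
      using \<delta> e power_decreasing[of 1 3 e] by (intro mult_left_mono) auto
    finally show ?thesis using p0 by simp
  qed
  define D1 where "D1 = 1 + 2 * \<delta>"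
  have e'b: "e \<le> e'" "e' \<le> 1 / 80"
  proof -
    show "e \<le> e'" using e \<delta> by (simp add: e')
    have "e * (1 + 2 * \<delta>) \<le> 1 / 100 * (1 + 2 * (1 / 8))"
      using e \<delta> by (intro mult_mono) auto
    then show "e' \<le> 1 / 80" by (simp add: e')
  qed
  have pe': "2 * p \<le> e'" using p\<delta> e by (simp add: e' algebra_simps)
  define b where "b = (1 - p)\<^sup>2"
  define c where "c = 2 * p * (1 - p)"
  define t where "t = 1 - p\<^sup>2"
  define q where "q = 2 * p / (1 + p)"
  have t: "0 < t" "t \<le> 1"
    using p0 p1 power_strict_mono[of p 1 2] by (auto simp: t_def)
  have tf: "t = (1 - p) * (1 + p)" by (simp add: t_def power2_eq_square algebra_simps)
  have q: "c = t * q" "b = t * (1 - q)" "0 \<le> q" "q \<le> 2 * p" "q \<le> 1"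
    using p0 p1
    by (auto simp: c_def b_def tf q_def divide_le_eq power2_eq_square) (simp add: field_simps)
  have q_lower: "2 * p * (1 - p) \<le> q"
    using p0 by (simp add: q_def field_simps)
  \<comment> \<open>The balance of \<open>noconf_ge\<close> with drift \<open>e'\<close> and killing
    rate reduced by \<open>k\<close>. One factor 1 - \<eta> covers the curvature of
    \<open>(1 - p) ^ a\<close>, the other covers \<open>1 - EV\<close>; the factor
    \<open>1 - 4 * e'\<close> in \<open>c1\<close> cancels the constant terms, leaving exactly
    \<open>k * (p * a)\<close>.\<close>
  define k where "k = (1 - \<eta>)\<^sup>2"
  define c2 where "c2 = k * p / (2 * e')"
  define c1 where "c1 = c2 * (1 - 4 * e') / e'"
  \<comment> \<open>The exponential must not grow on average: to second order e be = e^2/4 has to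
    exceed ga + be^2/2 = e^2/16 + e^2/32. In \<open>K\<close>, the 64 comes from bounding
    \<open>V\<close> by the quadratic Taylor polynomial of exp (be j / 2), and exp (-x/8) is what
    the exponential has gained when the region is left.\<close>
  define be where "be = e / 4"
  define ga where "ga = e\<^sup>2 / 16"
  define K where "K = exp (- x / 8) * (64 * p / e ^ 3)"
  define V where "V j = c1 * real j + c2 * (real j)\<^sup>2" for j :: nat
  \<comment> \<open>The exponential term is negligible at the starting point but exceeds \<open>V\<close> once \<open>n - m\<close> leaves
      \<open>[0, \<delta> e n)\<close> or \<open>a\<close> leaves \<open>[0, x / e)\<close>, so drift and killing need controlling only inside.\<close>
  define W where "W m a = 1 - V a + K * (exp (ga * (real n - real m)) * (exp (be * real a) - 1))" for m a :: nat
  have k: "0 \<le> k" "k \<le> 1" using \<eta> by (auto simp: k_def power_le_one)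
  have cs: "0 \<le> c1" "0 \<le> c2" using k p0 e e'b by (auto simp: c1_def c2_def)
  have c_le: "c2 \<le> p / (2 * e)" "c1 \<le> p / (2 * e\<^sup>2)"
  proof -
    have "k * p \<le> 1 * p" using k p0 by (intro mult_right_mono) auto
    then show c2: "c2 \<le> p / (2 * e)" unfolding c2_def using e e'b p0 by (intro frac_le) auto
    have "c2 * (1 - 4 * e') \<le> c2 * 1" using cs e e'b by (intro mult_left_mono) auto
    then have "c1 \<le> (p / (2 * e)) / e"
      unfolding c1_def using c2 e e'b p0 by (intro frac_le) auto
    then show "c1 \<le> p / (2 * e\<^sup>2)" by (simp add: power2_eq_square)
  qed
  have V_le: "V j \<le> p / (2 * e\<^sup>2) * (j + e * (real j)\<^sup>2)" for j
  proof -
    have "V j \<le> p / (2 * e\<^sup>2) * j + p / (2 * e) * (real j)\<^sup>2"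
      unfolding V_def using c_le by (intro add_mono mult_right_mono) auto
    also have "\<dots> = p / (2 * e\<^sup>2) * (j + e * (real j)\<^sup>2)"
      using e by (simp add: field_simps power2_eq_square)
    finally show ?thesis .
  qed
  have K0: "0 \<le> K" using p0 e by (simp add: K_def)
  have V_le_exp: "V j \<le> 64 * p / e ^ 3 * (exp (be * j / 2) - 1)" for j
  proof -
    have "1 + be * j / 2 + (be * j / 2)\<^sup>2 / 2 \<le> exp (be * j / 2)"
      using e by (intro exp_lower_Taylor_quadratic) (auto simp: be_def)
    moreover have "(e / 128) * (j + e * (real j)\<^sup>2) \<le> be * j / 2 + (be * j / 2)\<^sup>2 / 2"
      using e by (simp add: be_def power2_eq_square algebra_simps)
    ultimately have "(e / 128) * (j + e * (real j)\<^sup>2) \<le> exp (be * j / 2) - 1" by linarith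
    then have "64 * p / e ^ 3 * ((e / 128) * (j + e * (real j)\<^sup>2)) \<le> 64 * p / e ^ 3 * (exp (be * j / 2) - 1)"
      using p0 e by (intro mult_left_mono) auto
    moreover have "64 * p / e ^ 3 * ((e / 128) * (j + e * (real j)\<^sup>2)) = p / (2 * e\<^sup>2) * (j + e * (real j)\<^sup>2)"
      using e by (simp add: field_simps power2_eq_square power3_eq_cube)
    ultimately show ?thesis using V_le[of j] by linarith
  qed
  have region: "real n - real m < \<delta> * e * n \<and> real j < x / e"
    if "m \<le> n" "W m j < 1" for m j
  proof (rule ccontr)
    assume out: "\<not> ?thesis"
    \<comment> \<open>Half of the height exponential is spent on overcoming exp (-x/8), the other
      half on dominating \<open>V\<close>. The split works because Y^2 - 1 is at least Y (Y -
      1).\<close>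
    define Y where "Y = exp (be * j / 2)"
    have Y1: "1 \<le> Y" using e by (simp add: Y_def be_def)
    have YY: "exp (be * j) = Y * Y" by (simp add: Y_def exp_add[symmetric])
    have "1 \<le> exp (- x / 8) * exp (ga * (real n - real m)) * Y"
    proof (cases "\<delta> * e * n \<le> real n - real m")
      case True
      have "ga * (\<delta> * e * n) = \<delta> * (n * e ^ 3) / 16"
        by (simp add: ga_def power2_eq_square power3_eq_cube)
      then have "x / 8 \<le> ga * (\<delta> * e * n)"
        using L\<delta> xx by linarith
      also have "\<dots> \<le> ga * (real n - real m)" using True by (intro mult_left_mono) (auto simp: ga_def)
      finally have "1 * 1 \<le> exp (- x / 8 + ga * (real n - real m)) * Y"
        using Y1 by (intro mult_mono) auto
      then show ?thesis unfolding exp_add by simp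
    next
      case False
      with out have "x / e \<le> j" by simp
      then have "x / 8 \<le> be * j / 2" using e by (simp add: be_def field_simps)
      then have "1 \<le> exp (- x / 8 + be * j / 2)" by simp
      moreover have "1 \<le> exp (ga * (real n - real m))" using that by (simp add: ga_def)
      ultimately have "1 * 1 \<le> exp (ga * (real n - real m)) * exp (- x / 8 + be * j / 2)"
        by (intro mult_mono) auto
      then show ?thesis by (simp only: exp_add Y_def) (simp add: mult_ac)
    qed
    then have "1 * (Y - 1) \<le> (exp (- x / 8) * exp (ga * (real n - real m)) * Y) * (Y - 1)"
      using Y1 by (intro mult_right_mono) auto
    also have "\<dots> \<le> (exp (- x / 8) * exp (ga * (real n - real m))) * (Y * Y - 1)"
    proof -
      have "Y * (Y - 1) \<le> Y * Y - 1" using Y1 by (simp add: algebra_simps)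
      then show ?thesis by (simp add: mult.assoc mult_left_mono)
    qed
    finally have "64 * p / e ^ 3 * (1 * (Y - 1))
        \<le> 64 * p / e ^ 3 * ((exp (- x / 8) * exp (ga * (real n - real m))) * (Y * Y - 1))"
      using p0 e by (intro mult_left_mono) auto
    also have "\<dots> = K * (exp (ga * (real n - real m)) * (exp (be * j) - 1))"
      by (simp add: K_def YY)
    finally have "V j \<le> K * (exp (ga * (real n - real m)) * (exp (be * j) - 1))"
      using V_le_exp[of j] by (simp add: Y_def)
    then show False using that by (simp add: W_def)
  qed
  have step: "(1 - p) ^ a * bsum m b c (\<lambda>i. W (m - i) (a + i)) \<le> W m (Suc a)"
    if ma: "m + a < n" and W1: "W m (Suc a) < 1" for m a
  proof -
    define mu where "mu = m * q"
    define D where "D = 1 - mu"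
    define EV where "EV = c1 * (a + mu) + c2 * ((a + mu)\<^sup>2 + mu * (1 - q))"
    define s where "s = real n - real m"
    define X where "X = exp (be * a) * (1 + q * (exp (ga + be) - 1)) ^ m - (1 + q * (exp ga - 1)) ^ m"
    have reg: "s < \<delta> * e * n" "real (Suc a) < x / e"
      using region[of m "Suc a"] ma W1 by (auto simp: s_def)
    have qn: "n * q \<le> 1 - e"
    proof -
      have "n * q \<le> n * (2 * p)" using q by (intro mult_left_mono) auto
      then show ?thesis using np by simp
    qed
    have mu0: "0 \<le> mu" "mu \<le> 1 - e"
    proof -
      show "0 \<le> mu" using q by (simp add: mu_def)
      have "m * q \<le> n * q" using ma q by (intro mult_right_mono) auto
      then show "mu \<le> 1 - e" using qn by (simp add: mu_def)
    qed
    \<comment> \<open>Three effects lower the mean offspring: the drift \<open>e\<close>, depletion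
      by at most \<delta> e, and a correction \<open>p\<close>, itself at most \<delta> e. Together
      they give \<open>e'\<close>.\<close>
    have mu1: "1 - e' \<le> mu"
    proof -
      have "1 - e' \<le> (1 - e) * (1 - \<delta> * e) * (1 - p)"
      proof -
        have de: "0 \<le> \<delta> * e" "\<delta> * e \<le> 1" using \<delta> e mult_mono[of \<delta> 1 e 1] by auto
        have "1 - e - \<delta> * e \<le> (1 - e) * (1 - \<delta> * e)" using e \<delta> by (simp add: algebra_simps)
        moreover have "(1 - e) * (1 - \<delta> * e) - p \<le> (1 - e) * (1 - \<delta> * e) * (1 - p)"
        proof -
          have "(1 - e) * (1 - \<delta> * e) \<le> 1" using e de by (intro mult_le_one) auto
          then have "(1 - e) * (1 - \<delta> * e) * p \<le> 1 * p" using p0 by (intro mult_right_mono) auto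
          then show ?thesis by (simp add: algebra_simps)
        qed
        ultimately show ?thesis using p\<delta> by (simp add: e' algebra_simps)
      qed
      also have "\<dots> = (1 - \<delta> * e) * n * (2 * p * (1 - p))" unfolding np[symmetric] by simp
      also have "\<dots> \<le> m * (2 * p * (1 - p))"
        using reg p0 p1 by (intro mult_right_mono) (auto simp: s_def algebra_simps)
      also have "\<dots> \<le> mu" unfolding mu_def using q_lower by (intro mult_left_mono) auto
      finally show ?thesis .
    qed
    have "bsum m b c (\<lambda>i. W (m - i) (a + i)) = t ^ m * bsum m (1 - q) q (\<lambda>i. W (m - i) (a + i))"
      unfolding q by (rule bsum_normalize)
    also have "bsum m (1 - q) q (\<lambda>i. W (m - i) (a + i)) = bsum m (1 - q) q (\<lambda>i. 1 - V (a + i)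
        + K * (exp (ga * s) * (exp (be * a) * exp (ga + be) ^ i - exp ga ^ i)))"
      by (rule bsum_cong)
         (simp add: W_def s_def of_nat_diff exp_of_nat_mult[symmetric] exp_add[symmetric] algebra_simps)
    also have "\<dots> = 1 - EV + K * (exp (ga * s) * X)"
    proof -
      have "bsum m (1 - q) q (\<lambda>i. V (a + i)) = EV"
        unfolding V_def EV_def mu_def by (rule bsum_quadratic_shift) simp
      then show ?thesis
        unfolding bsum_add bsum_diff bsum_cmult bsum_const bsum_power
        by (simp add: X_def algebra_simps)
    qed
    finally have eq: "bsum m b c (\<lambda>i. W (m - i) (a + i)) = t ^ m * (1 - EV + K * (exp (ga * s) * X))" .
    \<comment> \<open>The supermartingale property of the exponential term. The power subtracted in
      \<open>X\<close> is at least 1 and so accounts for the -1 on the right.\<close>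
    have X: "X \<le> exp (be * Suc a) - 1"
    proof -
      define u where "u = ga + be"
      have ee: "0 \<le> e * e" "e * e \<le> 1 / 100 * e" using e by (auto intro: mult_right_mono)
      have u: "0 \<le> u" "u \<le> 1" "u \<le> be * (1 + e / 4)" "u \<le> e / 2"
      proof -
        have "u = e / 4 + e * e / 16" "be * (1 + e / 4) = e / 4 + e * e / 16"
          by (simp_all add: u_def ga_def be_def power2_eq_square algebra_simps)
        then show "0 \<le> u" "u \<le> 1" "u \<le> be * (1 + e / 4)" "u \<le> e / 2"
          using e ee by linarith+
      qed
      have "(1 - e) * (exp u - 1) \<le> be"
      proof -
        have "exp u - 1 \<le> u * (1 + u)"
          using exp_bound[of u] u by (simp add: power2_eq_square algebra_simps)
        also have "\<dots> \<le> (be * (1 + e / 4)) * (1 + e / 2)"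
          using u e by (intro mult_mono) (auto simp: be_def)
        also have "\<dots> \<le> be * (1 + e)"
        proof -
          have "(1 + e / 4) * (1 + e / 2) = 1 + 3 / 4 * e + e * e / 8"
            by (simp add: algebra_simps)
          then have "(1 + e / 4) * (1 + e / 2) \<le> 1 + e" using e ee by linarith
          then have "be * ((1 + e / 4) * (1 + e / 2)) \<le> be * (1 + e)"
            using e by (intro mult_left_mono) (auto simp: be_def)
          then show ?thesis by (simp only: mult.assoc)
        qed
        finally have "(1 - e) * (exp u - 1) \<le> (1 - e) * (be * (1 + e))"
          using e by (intro mult_left_mono) auto
        also have "\<dots> = be * (1 - e * e)" by (simp add: algebra_simps)
        also have "\<dots> \<le> be * 1" using e by (intro mult_left_mono) (auto simp: be_def)
        finally show ?thesis by simp
      qed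
      moreover have "mu * (exp u - 1) \<le> (1 - e) * (exp u - 1)"
        using mu0 u by (intro mult_right_mono) auto
      moreover have "(1 + q * (exp u - 1)) ^ m \<le> exp (m * (q * (exp u - 1)))"
        using q u by (intro power_le_exp_mult) auto
      ultimately have "(1 + q * (exp u - 1)) ^ m \<le> exp be"
        unfolding mu_def by (smt (verit) exp_le_cancel_iff mult.assoc)
      then have "exp (be * a) * (1 + q * (exp u - 1)) ^ m \<le> exp (be * a) * exp be"
        by (intro mult_left_mono) auto
      moreover have "1 \<le> (1 + q * (exp ga - 1)) ^ m"
        using q by (intro one_le_power) (auto simp: ga_def)
      ultimately show ?thesis by (simp add: X_def u_def exp_add[symmetric] algebra_simps)
    qed
    have pa0: "0 \<le> p * a" using p0 by simp
    have nexe: "n * e ^ 3 * p * (x / e) \<le> x * e\<^sup>2 / 2"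
    proof -
      have "2 * p * (n * e ^ 3) * (x / e) \<le> e ^ 3 * (x / e)"
        using pL x e by (intro mult_right_mono) auto
      also have "\<dots> = x * e\<^sup>2" using e by (simp add: power2_eq_square power3_eq_cube)
      finally show ?thesis by (simp add: mult_ac)
    qed
    \<comment> \<open>Inside the region both the killing exponent p a and the expected penalty
      \<open>EV\<close> are at most \<eta>; this is what the largeness of n e^3 relative to x^2 /
      \<eta> provides.\<close>
    have pa: "p * a \<le> \<eta>"
    proof -
      have "p * a \<le> p * (x / e)" using reg p0 by (intro mult_left_mono) auto
      also have "\<dots> \<le> \<eta>"
      proof -
        have "n * e ^ 3 * (p * (x / e)) \<le> x * e\<^sup>2 / 2" using nexe by (simp add: mult_ac)
        also have "\<dots> \<le> x\<^sup>2 * 1"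
          using xx x e power_le_one[of e 2] mult_mono[of x "x\<^sup>2" "e\<^sup>2" 1] by simp
        also have "\<dots> \<le> n * e ^ 3 * \<eta>" using L\<eta> xx by (simp add: mult_ac)
        finally show ?thesis using Lpos mult_le_cancel_left_pos[OF Lpos] by blast
      qed
      finally show ?thesis .
    qed
    have EV0: "EV \<le> \<eta>"
    proof -
      have "mu * (1 - q) \<le> 1 * 1" using mu0 q e by (intro mult_mono) auto
      moreover have "a + mu \<le> Suc a" using mu0 e by simp
      moreover have "(a + mu)\<^sup>2 \<le> (real (Suc a))\<^sup>2" using mu0 e by (intro power_mono) auto
      ultimately have "EV \<le> c1 * Suc a + c2 * ((real (Suc a))\<^sup>2 + 1)"
        unfolding EV_def using cs by (intro add_mono mult_left_mono) auto
      also have "\<dots> = V (Suc a) + c2" by (simp add: V_def algebra_simps)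
      also have "\<dots> \<le> p / (2 * e\<^sup>2) * (Suc a + e * (real (Suc a))\<^sup>2) + p / (2 * e)"
        by (intro add_mono V_le c_le)
      also have "\<dots> \<le> p / (2 * e\<^sup>2) * (x / e + e * (x / e)\<^sup>2) + p / (2 * e\<^sup>2) * (x / e)"
      proof (intro add_mono mult_left_mono power_mono)
        have "p / (2 * e) * 1 \<le> p / (2 * e) * (x / e\<^sup>2)"
          using p0 e x power_le_one[of e 2] by (intro mult_left_mono) (auto simp: le_divide_eq)
        also have "\<dots> = p / (2 * e\<^sup>2) * (x / e)" using e by (simp add: field_simps power2_eq_square)
        finally show "p / (2 * e) \<le> p / (2 * e\<^sup>2) * (x / e)" by simp
      qed (use reg p0 e in auto)
      also have "\<dots> = p / (2 * e ^ 3) * (2 * x + x\<^sup>2)"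
        using e by (simp add: field_simps power2_eq_square power3_eq_cube)
      also have "\<dots> \<le> p / (2 * e ^ 3) * (3 * x\<^sup>2)"
        using xx p0 e by (intro mult_left_mono) auto
      also have "\<dots> \<le> p / (2 * e ^ 3) * (\<eta> * (n * e ^ 3))"
        using L\<eta> p0 e xx by (intro mult_left_mono) auto
      also have "\<dots> = \<eta> * (n * p) / 2" using e by simp
      also have "\<dots> \<le> \<eta>"
      proof -
        have "\<eta> * (n * p) \<le> \<eta> * 1" using np e \<eta> by (intro mult_left_mono) auto
        then show ?thesis using \<eta> by simp
      qed
      finally show ?thesis .
    qed
    have main: "(1 - p) ^ a * (1 - EV) \<le> 1 - V (Suc a)"
    proof -
      have "V (Suc a) - EV = c1 * D + c2 * (2 * Suc a * D - D\<^sup>2 - mu * (1 - q))"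
        by (simp add: V_def EV_def D_def algebra_simps power2_eq_square)
      also have "\<dots> \<le> c1 * e' + c2 * (2 * Suc a * e' - (1 - 2 * e'))"
      proof -
        have D: "D \<le> e'" using mu1 by (simp add: D_def)
        have "mu * q \<le> 1 * (2 * p)" using mu0 q e p0 by (intro mult_mono) auto
        then have "1 - 2 * e' \<le> mu * (1 - q)" using mu1 pe' by (simp add: algebra_simps)
        moreover have "2 * real (Suc a) * D \<le> 2 * Suc a * e'"
          using mult_left_mono[OF D, of "2 * real (Suc a)"] by simp
        moreover have "0 \<le> D\<^sup>2" by simp
        ultimately have "2 * Suc a * D - D\<^sup>2 - mu * (1 - q) \<le> 2 * Suc a * e' - (1 - 2 * e')" by linarith
        then show ?thesis using cs D by (intro add_mono mult_left_mono) auto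
      qed
      also have "\<dots> = k * (p * a)"
        using e e'b by (simp add: c1_def c2_def field_simps)
      also have "\<dots> = (p * a * (1 - \<eta>)) * (1 - \<eta>)" by (simp add: k_def power2_eq_square)
      also have "\<dots> \<le> (1 - (1 - p) ^ a) * (1 - EV)"
      proof (intro mult_mono)
        have "(1 - p) ^ a \<le> 1 - p * a + (p * a)\<^sup>2"
          using power_one_minus_le_exp[of p a] exp_neg_le[OF pa0] p0 p1 by simp
        moreover have "(p * a)\<^sup>2 \<le> p * a * \<eta>"
          using pa pa0 by (simp add: power2_eq_square mult_left_mono)
        ultimately show "p * a * (1 - \<eta>) \<le> 1 - (1 - p) ^ a" by (simp add: algebra_simps)
      qed (use EV0 \<eta> p0 p1 in \<open>auto simp: power_le_one\<close>)
      finally show ?thesis by (simp add: algebra_simps)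
    qed
    \<comment> \<open>The factor \<open>t ^ m\<close> stands for variables hit in both signs at
      once. For an upper bound it is replaced by 1, which is legitimate because
      \<open>1 - EV\<close> is nonnegative.\<close>
    have "(1 - p) ^ a * (t ^ m * (1 - EV)) \<le> (1 - p) ^ a * (1 * (1 - EV))"
      using p0 p1 t EV0 \<eta> by (intro mult_left_mono mult_right_mono) (auto simp: power_le_one)
    moreover have "((1 - p) ^ a * t ^ m) * (K * (exp (ga * s) * X))
        \<le> 1 * (K * (exp (ga * s) * (exp (be * Suc a) - 1)))"
    proof -
      have "((1 - p) ^ a * t ^ m) * (K * (exp (ga * s) * X))
        \<le> ((1 - p) ^ a * t ^ m) * (K * (exp (ga * s) * (exp (be * Suc a) - 1)))"
        using X K0 p0 p1 t by (intro mult_left_mono) auto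
      also have "\<dots> \<le> 1 * (K * (exp (ga * s) * (exp (be * Suc a) - 1)))"
        using K0 p0 p1 t e by (intro mult_right_mono mult_le_one) (auto simp: power_le_one be_def)
      finally show ?thesis .
    qed
    ultimately show ?thesis
      using main unfolding eq by (simp add: W_def s_def algebra_simps)
  qed
  have "noconf p n 1 \<le> W (n - 1) 1"
  proof (rule noconf_le_supersolution[where n = n])
    show "1 \<le> W m 0" for m by (simp add: W_def V_def)
  qed (use step p0 p1 n in \<open>auto simp: b_def c_def\<close>)
  also have "W (n - 1) 1 = 1 - c1 - c2 + K * (exp ga * (exp be - 1))"
    using n by (simp add: W_def V_def of_nat_diff)
  \<comment> \<open>With be = e/4 the cost of the exponential term at the start is at most 4 be K =
    e K, which is 128 exp (-x/8) in units of p / (2 e^2).\<close>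
  also have "K * (exp ga * (exp be - 1)) \<le> K * (2 * (2 * be))"
  proof -
    have be: "0 \<le> be" "be \<le> 1 / 2" "0 \<le> ga" "ga \<le> 1 / 2"
      using e power_le_one[of e 2] by (auto simp: be_def ga_def)
    have "exp be \<le> 1 + 2 * be" "exp ga \<le> 1 + 2 * ga"
      using exp_bound_lemma[of be] exp_bound_lemma[of ga] be by auto
    then show ?thesis using K0 be by (intro mult_left_mono mult_mono) auto
  qed
  also have "K * (2 * (2 * be)) = p / (2 * e\<^sup>2) * (128 * exp (- x / 8))"
    using e by (simp add: K_def be_def field_simps power2_eq_square power3_eq_cube)
  also have "1 - c1 - c2 \<le> 1 - p / (2 * e\<^sup>2) * (k * (1 - 4 * e') / (1 + 2 * \<delta>)\<^sup>2)"
  proof -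
    have "c1 = p / (2 * e\<^sup>2) * (k * (1 - 4 * e') / (1 + 2 * \<delta>)\<^sup>2)"
      unfolding c1_def c2_def e' D1_def[symmetric] using e \<delta>
      by (simp add: field_simps power2_eq_square)
    then show ?thesis using cs by simp
  qed
  finally show ?thesis by (simp add: k_def algebra_simps)
qed

section \<open>Lower bound for contradictions above the threshold\<close>

lemma exp_le_power_one_minus:
  fixes y :: real
  assumes "0 \<le> y" "y \<le> 1 / 2"
  shows "exp (- (n * (y + 2 * y\<^sup>2))) \<le> (1 - y) ^ n"
proof -
  have "exp (- y - 2 * y\<^sup>2) \<le> exp (ln (1 - y))"
    using ln_one_minus_pos_lower_bound[OF assms] by (subst exp_le_cancel_iff)
  then have "exp (- y - 2 * y\<^sup>2) ^ n \<le> (1 - y) ^ n"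
    using assms by (intro power_mono) auto
  then show ?thesis by (simp add: exp_of_nat_mult[symmetric] algebra_simps)
qed

text \<open>\<open>root\<close> uses the drift (1 - 3 \<delta>) e that is guaranteed until about
  \<delta> e n variables have been touched, so \<open>r\<close> is slightly larger than the
  extinction probability at drift e. The factor exp (4 x) in \<open>L\<close> is the price of the
  concavity term: at height x / e, \<open>h ^ a\<close> has dropped to exp (-4 x).\<close>

lemma noconf_le_supercritical:
  fixes e \<delta> x p r :: real
  assumes e: "0 < e" "e \<le> 1 / 100" and \<delta>: "0 < \<delta>" "\<delta> \<le> 1 / 8"
    and x: "1 \<le> x" and n: "1 \<le> n" and p: "p = (1 + e) / (2 * real n)"
    and r: "0 < r" "r < 1" and root: "exp (- ((1 + (1 - 3 * \<delta>) * e) * (1 - r))) \<le> r"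
    and L: "x * exp (4 * x) / \<delta> \<le> n * e ^ 3"
  shows "noconf p n 1 \<le> r + 2 * exp (- (x * \<delta> / 16)) * ((1 - r) + 4 * e)"
proof -
  have n0: "0 < real n" using n by simp
  have Lpos: "0 < n * e ^ 3" using n e by simp
  have Lx: "x * exp (4 * x) \<le> \<delta> * (n * e ^ 3)"
    using L \<delta> by (simp add: field_simps)
  have L1: "x * exp (4 * x) \<le> n * e ^ 3"
  proof -
    have "\<delta> * (n * e ^ 3) \<le> 1 * (n * e ^ 3)" using \<delta> Lpos by (intro mult_right_mono) auto
    with Lx show ?thesis by simp
  qed
  have L5: "5 * x \<le> \<delta> * (n * e ^ 3)"
  proof -
    have "5 \<le> exp (4 * x)" using exp_ge_add_one_self[of "4 * x"] x by linarith
    then have "5 * x \<le> x * exp (4 * x)" using x by simp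
    with Lx show ?thesis by simp
  qed
  have e3: "e ^ 3 = e * e * e" by (simp add: power3_eq_cube)
  have ee: "0 < e * e" "e * e \<le> 1 / 100 * e" "0 < e * e * e" "e * e * e \<le> 1 / 100 * (e * e)"
  proof -
    show "0 < e * e" "0 < e * e * e" using e by auto
    show "e * e \<le> 1 / 100 * e" using e by (intro mult_right_mono) auto
    then have "(e * e) * e \<le> (1 / 100 * e) * e" using e by (intro mult_right_mono) auto
    then show "e * e * e \<le> 1 / 100 * (e * e)" by simp
  qed
  have p0: "0 < p" using e n0 by (simp add: p)
  have np: "2 * (n * p) = 1 + e" using n0 by (simp add: p)
  have pn: "p \<le> 1 / n" using e n0 by (simp add: p field_simps)
  have pn': "1 / (2 * n) \<le> p" using e n0 by (simp add: p divide_right_mono)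
  have nd: "1 / n \<le> \<delta> * (e * e * e) / 5"
  proof -
    have "5 * 1 \<le> \<delta> * (e * e * e) * n" using L5 x by (simp add: e3 mult_ac)
    then show ?thesis using n0 by (simp add: divide_le_eq)
  qed
  have nd': "\<delta> * (e * e * e) / 5 \<le> (e * e * e) / 40" "\<delta> * (e * e * e) / 5 \<le> \<delta> * e / 5"
  proof -
    show "\<delta> * (e * e * e) / 5 \<le> (e * e * e) / 40" using \<delta> ee by simp
    have "e * e * e \<le> e" using ee e by linarith
    then show "\<delta> * (e * e * e) / 5 \<le> \<delta> * e / 5" using \<delta> by simp
  qed
  have p_small: "p \<le> 1 / 100" using pn nd nd' ee e by linarith
  define b where "b = (1 - p)\<^sup>2"
  define c where "c = 2 * p * (1 - p)"
  have c0: "0 \<le> c" "c \<le> 2 * p" using p0 p_small by (auto simp: c_def)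
  have b0: "0 \<le> b" by (simp add: b_def)
  have bc: "b + c * z = 1 - p\<^sup>2 - c * (1 - z)" for z
    by (simp add: b_def c_def power2_eq_square algebra_simps)
  \<comment> \<open>\<open>ga\<close> is the largest rate that killing can pay for: p a is at least
    4 ga once a reaches x / (2 e). \<open>M\<close> solves e^2 M exp (-4 x) = 4 ga, so that the
    concavity gain pays the same amount below that height.\<close>
  define ga where "ga = x / (16 * n * e)"
  define T where "T = \<delta> * e * n"
  define M where "M = 4 * ga * exp (4 * x) / e\<^sup>2"
  define g where "g = exp ga"
  define h where "h = exp (- (4 * e))"
  \<comment> \<open>Up to \<open>n - m = T\<close> the drift stays close to \<open>e\<close>.  The factor decaying at rate \<open>ga\<close> is paid for by
      killing when \<open>a > x / e\<close>, and by the strict concavity of \<open>1 - h ^ a\<close> (\<open>h\<close> lies beyond the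
      extinction root \<open>\<approx> exp (- 2 e)\<close>) when \<open>a \<le> x / e\<close>.\<close>
  define W where "W m a = r ^ a + exp (ga * (real n - real m - T)) * ((1 - r ^ a) + M * (1 - h ^ a))"
    for m a :: nat
  have ga0: "0 < ga" using x n0 e by (simp add: ga_def)
  have ga1: "ga \<le> 1 / 10"
  proof -
    have "ga = x / (n * e ^ 3) * (e * e) / 16"
      using e n0 by (simp add: ga_def e3 field_simps)
    also have "\<dots> \<le> 1 * (e * e) / 16"
    proof (intro divide_right_mono mult_right_mono)
      have "x * 1 \<le> x * exp (4 * x)" using x by (intro mult_left_mono) auto
      then show "x / (n * e ^ 3) \<le> 1" using L1 Lpos by (simp add: divide_le_eq)
    qed (use ee in auto)
    finally show ?thesis using ee e by linarith
  qed
  have gT: "ga * T = x * \<delta> / 16" using e n0 by (simp add: ga_def T_def)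
  have M: "0 \<le> M" "M \<le> 1"
  proof -
    show "0 \<le> M" using ga0 by (simp add: M_def)
    have "M = x * exp (4 * x) / (n * e ^ 3) / 4"
      using e n0 by (simp add: M_def ga_def e3 power2_eq_square)
    also have "\<dots> \<le> 1 / 4" using L1 Lpos by (intro divide_right_mono) (auto simp: divide_le_eq)
    finally show "M \<le> 1" by simp
  qed
  have h: "0 < h" "h \<le> 1" "1 - h \<le> 4 * e" "1 - h \<le> 4 * e - 59 / 10 * (e * e)"
  proof -
    show "0 < h" "h \<le> 1" using e by (auto simp: h_def)
    show "1 - h \<le> 4 * e" using exp_ge_add_one_self[of "- (4 * e)"] by (simp add: h_def)
    have "(1 - e) ^ 4 \<le> exp (- (4 * e))"
      using power_one_minus_le_exp[of e 4] e by (simp add: mult.commute)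
    moreover have "(1 - e) ^ 4 = 1 - 4 * e + 6 * (e * e) - 4 * (e * e * e) + (e * e) * (e * e)"
      by (simp add: algebra_simps power4_eq_xxxx)
    moreover have "0 \<le> (e * e) * (e * e)" by simp
    ultimately show "1 - h \<le> 4 * e - 59 / 10 * (e * e)" using ee unfolding h_def by linarith
  qed
  have P1: "(b + c * r) ^ m \<le> r" if "real n - T < m" for m :: nat
  proof -
    have "b + c * r = 1 + (- (p\<^sup>2 + c * (1 - r)))" by (simp add: bc)
    then have "(b + c * r) ^ m \<le> exp (m * (- (p\<^sup>2 + c * (1 - r))))"
      using power_le_exp_mult[of "- (p\<^sup>2 + c * (1 - r))" m] b0 c0 r
      by (metis add_nonneg_nonneg less_eq_real_def mult_nonneg_nonneg)
    also have "\<dots> \<le> exp (- ((1 + (1 - 3 * \<delta>) * e) * (1 - r)))"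
    proof (subst exp_le_cancel_iff)
      \<comment> \<open>Depletion costs \<delta> e + \<delta> e^2 and the factor 1 - p costs at most
        2 p, which is no more than 2 \<delta> e / 5; 3 \<delta> e covers the sum.\<close>
      have "1 + (1 - 3 * \<delta>) * e \<le> (n - T) * c"
      proof -
        have "(n - T) * c = (2 * (n * p)) * (1 - \<delta> * e) * (1 - p)"
          by (simp add: T_def c_def algebra_simps)
        also have "\<dots> = (1 + e) * (1 - \<delta> * e) - p * ((1 + e) * (1 - \<delta> * e))"
          unfolding np by (simp add: algebra_simps)
        also have "\<dots> \<ge> (1 + e) * (1 - \<delta> * e) - p * (2 * 1)"
        proof (intro diff_left_mono mult_left_mono mult_mono)
          show "1 - \<delta> * e \<le> 1" "0 \<le> 1 - \<delta> * e"
            using mult_mono[of \<delta> 1 e 1] e \<delta> by auto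
        qed (use p0 e in auto)
        finally have "(1 + e) * (1 - \<delta> * e) - 2 * p \<le> (n - T) * c" by simp
        moreover have "(1 + e) * (1 - \<delta> * e) = 1 + e - \<delta> * e - \<delta> * (e * e)" by (simp add: algebra_simps)
        moreover have "\<delta> * (e * e) \<le> \<delta> * (1 / 100 * e)" using ee \<delta> by (intro mult_left_mono) auto
        moreover have "0 < \<delta> * e" using e \<delta> by simp
        ultimately show ?thesis using pn nd nd' by (simp add: algebra_simps)
      qed
      also have "\<dots> \<le> m * c" using that c0 by (intro mult_right_mono) auto
      finally have "(1 + (1 - 3 * \<delta>) * e) * (1 - r) \<le> (m * c) * (1 - r)"
        using r by (intro mult_right_mono) auto
      also have "\<dots> \<le> m * (p\<^sup>2 + c * (1 - r))" by (simp add: algebra_simps)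
      finally show "m * (- (p\<^sup>2 + c * (1 - r))) \<le> - ((1 + (1 - 3 * \<delta>) * e) * (1 - r))"
        by (simp only: mult_minus_right neg_le_iff_le)
    qed
    finally show ?thesis using root by simp
  qed
  have P2: "(b + c * g) ^ m \<le> 1 + 2 * ga" if "m \<le> n" for m
  proof -
    have g1: "0 \<le> g - 1" "g - 1 \<le> ga + ga\<^sup>2"
      using ga0 ga1 exp_bound[of ga] by (auto simp: g_def)
    have "(b + c * g) ^ m \<le> (1 + c * (g - 1)) ^ m"
    proof (rule power_mono)
      show "b + c * g \<le> 1 + c * (g - 1)" by (simp add: bc algebra_simps)
    qed (use b0 c0 g1 in auto)
    also have "\<dots> \<le> exp (m * (c * (g - 1)))" using c0 g1 by (intro power_le_exp_mult) auto
    also have "\<dots> \<le> exp (6 / 5 * ga)"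
    proof (subst exp_le_cancel_iff)
      have "m * c \<le> n * (2 * p)" using that c0 by (intro mult_mono) auto
      then have "m * c \<le> 1 + e" using np by simp
      then have "(m * c) * (g - 1) \<le> (101 / 100) * (ga + ga\<^sup>2)"
        using g1 e c0 by (intro mult_mono) auto
      also have "\<dots> \<le> (101 / 100) * (ga + 1 / 10 * ga)"
        using ga0 ga1 by (intro mult_left_mono add_left_mono) (auto simp: power2_eq_square)
      also have "\<dots> \<le> 6 / 5 * ga" using ga0 by simp
      finally show "m * (c * (g - 1)) \<le> 6 / 5 * ga" by (simp add: mult.assoc)
    qed
    also have "\<dots> \<le> 1 + 6 / 5 * ga + (6 / 5 * ga)\<^sup>2" using ga0 ga1 by (intro exp_bound) auto
    also have "\<dots> \<le> 1 + 2 * ga"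
    proof -
      have "ga * ga \<le> 1 / 10 * ga" using ga0 ga1 by (intro mult_right_mono) auto
      moreover have "(6 / 5 * ga)\<^sup>2 = 36 / 25 * (ga * ga)" by (simp add: power2_eq_square)
      ultimately show ?thesis using ga0 by linarith
    qed
    finally show ?thesis .
  qed
  \<comment> \<open>Since \<open>h\<close> is exp (-4 e), its exponent is 4 e, whereas 2 n p (1 - h)
    is only about 4 e - 4 e^2. The gap of order e^2 yields the gain. The base is at most 1, so the
    bound at \<open>n\<close> passes to every smaller \<open>m\<close>.\<close>
  have P3: "h * (1 + e\<^sup>2) \<le> (b + c * h) ^ m" if "m \<le> n" for m
  proof -
    define y where "y = p\<^sup>2 + c * (1 - h)"
    define w where "w = 1 / real n"
    have w: "0 < w" "w \<le> (e * e * e) / 40" using n0 nd nd' by (auto simp: w_def)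
    have y0: "0 \<le> y" using c0 h by (simp add: y_def)
    have "c * (1 - h) \<le> 2 * p * (1 - h)" using c0 h by (intro mult_right_mono) auto
    then have y1: "y \<le> p * (p + 2 * (1 - h))" by (simp add: y_def power2_eq_square algebra_simps)
    have "p * (p + 2 * (1 - h)) \<le> p * (1 / 10)"
    proof (rule mult_left_mono)
      show "p + 2 * (1 - h) \<le> 1 / 10" using p_small h(3) e(2) by argo
    qed (use p0 in simp)
    with y1 have y2: "y \<le> p * (1 / 10)" by linarith
    have npp: "n * (p * p) \<le> w"
    proof -
      have "n * (p * p) \<le> n * (1 / n * p)" using p0 pn by (intro mult_left_mono mult_right_mono) auto
      also have "\<dots> = p" using n0 by simp
      finally show ?thesis using pn by (simp add: w_def)
    qed
    have "n * y \<le> n * (p * (p + 2 * (1 - h)))" using y1 by (intro mult_left_mono) auto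
    also have "\<dots> = n * (p * p) + (2 * (n * p)) * (1 - h)" by (simp add: algebra_simps)
    also have "\<dots> \<le> w + (1 + e) * (4 * e - 59 / 10 * (e * e))"
      unfolding np using npp h e by (intro add_mono mult_left_mono) auto
    finally have ny: "n * y \<le> w + (1 + e) * (4 * e - 59 / 10 * (e * e))" .
    have "y * y \<le> (p * (1 / 10)) * (p * (1 / 10))" using y0 y2 by (intro mult_mono) auto
    then have "n * (y * y) \<le> n * ((p * (1 / 10)) * (p * (1 / 10)))" by (intro mult_left_mono) auto
    also have "\<dots> = n * (p * p) / 100" by simp
    finally have "n * (y * y) \<le> w / 100" using npp by simp
    moreover have "(1 + e) * (4 * e - 59 / 10 * (e * e)) = 4 * e - 19 / 10 * (e * e) - 59 / 10 * (e * e * e)"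
      by (simp add: algebra_simps)
    ultimately have "n * y + 2 * (n * (y * y)) \<le> 4 * e - e * e"
      using ny w ee by linarith
    then have key: "n * (y + 2 * y\<^sup>2) \<le> 4 * e - e\<^sup>2" by (simp add: power2_eq_square algebra_simps)
    have "h * (1 + e\<^sup>2) \<le> h * exp (e\<^sup>2)"
      using h exp_ge_add_one_self[of "e\<^sup>2"] by (intro mult_left_mono) auto
    also have "\<dots> = exp (- (4 * e - e\<^sup>2))" by (simp add: h_def exp_add[symmetric])
    also have "\<dots> \<le> exp (- (n * (y + 2 * y\<^sup>2)))" using key by (subst exp_le_cancel_iff) linarith
    also have "\<dots> \<le> (1 - y) ^ n" using y0 y2 p_small by (intro exp_le_power_one_minus) auto
    also have "\<dots> \<le> (1 - y) ^ m" using that y0 y2 p_small by (intro power_decreasing) auto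
    also have "1 - y = b + c * h" by (simp add: bc y_def)
    finally show ?thesis .
  qed
  have step: "(1 - p) ^ a * bsum m b c (\<lambda>i. W (m - i) (a + i)) \<le> W m (Suc a)"
    if ma: "m + a < n" and W1: "W m (Suc a) < 1" for m a
  proof -
    define s where "s = real n - real m"
    define X where "X = exp (ga * (s - T))"
    define B where "B = 1 + M - M * h ^ Suc a"
    define B' where "B' = (1 + M) * (1 + 2 * ga) - M * h ^ Suc a * (1 + e\<^sup>2)"
    define \<sigma> where "\<sigma> = (1 - p) ^ a"
    have hj: "0 \<le> h ^ Suc a" "h ^ Suc a \<le> 1" using h by (auto intro!: power_le_one simp del: power_Suc)
    have rj: "0 \<le> r ^ Suc a" "r ^ Suc a \<le> 1" using r by (auto intro!: power_le_one simp del: power_Suc)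
    have sT: "s < T"
    proof (rule ccontr)
      assume "\<not> s < T"
      then have "1 \<le> X" using ga0 by (simp add: X_def)
      moreover have "0 \<le> M * (1 - h ^ Suc a)" using M hj by (intro mult_nonneg_nonneg) auto
      ultimately have "1 * (1 - r ^ Suc a) \<le> X * ((1 - r ^ Suc a) + M * (1 - h ^ Suc a))"
        using rj by (intro mult_mono) auto
      then show False using W1 by (simp add: W_def X_def s_def)
    qed
    have X: "0 < X" "X \<le> 1"
    proof -
      have "ga * (s - T) \<le> 0" using ga0 sT by (intro mult_nonneg_nonpos) auto
      then show "0 < X" "X \<le> 1" by (auto simp: X_def)
    qed
    have B1: "1 \<le> B"
    proof -
      have "M * h ^ Suc a \<le> M * 1" using M hj by (intro mult_left_mono) auto
      then show ?thesis by (simp add: B_def)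
    qed
    have \<sigma>: "0 \<le> \<sigma>" "\<sigma> \<le> 1" using p0 p_small by (auto simp: \<sigma>_def power_le_one)
    have g1: "1 \<le> g" using ga0 by (simp add: g_def)
    have "bsum m b c (\<lambda>i. W (m - i) (a + i)) = bsum m b c (\<lambda>i. r ^ a * r ^ i
        + X * ((1 + M) * g ^ i - r ^ a * (g * r) ^ i - M * h ^ a * (g * h) ^ i))"
    proof (rule bsum_cong)
      fix i assume "i \<le> m"
      then have "exp (ga * (real n - real (m - i) - T)) = X * g ^ i"
        by (simp add: X_def s_def g_def of_nat_diff exp_of_nat_mult[symmetric] exp_add[symmetric] algebra_simps)
      then show "W (m - i) (a + i) = r ^ a * r ^ i
        + X * ((1 + M) * g ^ i - r ^ a * (g * r) ^ i - M * h ^ a * (g * h) ^ i)"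
        by (simp add: W_def power_add power_mult_distrib algebra_simps)
    qed
    also have "\<dots> = r ^ a * (b + c * r) ^ m + X * ((1 + M) * (b + c * g) ^ m
        - r ^ a * (b + c * (g * r)) ^ m - M * h ^ a * (b + c * (g * h)) ^ m)"
      unfolding bsum_add bsum_diff bsum_cmult bsum_power by simp
    \<comment> \<open>In the two subtracted powers the factor \<open>g\<close>, which exceeds 1, is
      dropped; this can only enlarge the right-hand side.\<close>
    also have "\<dots> \<le> r ^ a * (b + c * r) ^ m + X * ((1 + M) * (1 + 2 * ga)
        - r ^ a * (b + c * r) ^ m - M * h ^ a * (h * (1 + e\<^sup>2)))"
    proof (intro add_left_mono mult_left_mono diff_mono)
      have "c * h \<le> c * (g * h)" using c0 h g1 by (intro mult_left_mono) auto
      then have "(b + c * h) ^ m \<le> (b + c * (g * h)) ^ m" using b0 c0 h by (intro power_mono) auto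
      then show "h * (1 + e\<^sup>2) \<le> (b + c * (g * h)) ^ m" using P3[of m] ma by simp
      have "c * r \<le> c * (g * r)" using c0 r g1 by (intro mult_left_mono) auto
      then show "(b + c * r) ^ m \<le> (b + c * (g * r)) ^ m" using b0 c0 r by (intro power_mono) auto
    qed (use P2[of m] ma M X r h in auto)
    also have "\<dots> = (1 - X) * r ^ a * (b + c * r) ^ m + X * B'"
    proof -
      have "R * P + X * (U - R * P - M * H * (h * q)) = (1 - X) * R * P + X * (U - M * (h * H) * q)"
        for R P U H q :: real by (simp add: algebra_simps)
      then show ?thesis unfolding B'_def power_Suc .
    qed
    also have "\<dots> \<le> (1 - X) * r ^ a * r + X * B'"
      using P1[of m] sT X r by (intro add_right_mono mult_left_mono) (auto simp: s_def)
    finally have bs: "bsum m b c (\<lambda>i. W (m - i) (a + i)) \<le> (1 - X) * r ^ Suc a + X * B'"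
      by (simp add: mult_ac)
    have B'B: "B' \<le> B + 4 * ga - e\<^sup>2 * M * h ^ Suc a"
    proof -
      have "(1 + M) * ga \<le> 2 * ga" using M ga0 by (intro mult_right_mono) auto
      then show ?thesis by (simp add: B_def B'_def algebra_simps)
    qed
    have \<sigma>B: "\<sigma> * B' \<le> B"
    proof (cases "real (Suc a) \<le> x / e")
      case True
      then have "4 * e * real (Suc a) \<le> 4 * x" using e by (simp add: field_simps)
      then have "exp (- (4 * x)) \<le> h ^ Suc a"
        unfolding h_def exp_of_nat_mult[symmetric] by (simp add: algebra_simps)
      then have "e\<^sup>2 * M * exp (- (4 * x)) \<le> e\<^sup>2 * M * h ^ Suc a"
        using M by (intro mult_left_mono) auto
      moreover have "e\<^sup>2 * M * exp (- (4 * x)) = 4 * ga"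
        using e by (simp add: M_def exp_minus)
      ultimately have "B' \<le> B" using B'B by simp
      then have "\<sigma> * B' \<le> \<sigma> * B" using \<sigma> by (intro mult_left_mono) auto
      also have "\<dots> \<le> 1 * B" using \<sigma> B1 by (intro mult_right_mono) auto
      finally show ?thesis by simp
    next
      case False
      \<comment> \<open>Killing acts with exponent \<open>a\<close> while the case distinction
        concerns \<open>Suc a\<close>; half of x / e absorbs the difference of one.\<close>
      have "1 \<le> x / (2 * e)" using x e by (simp add: field_simps)
      moreover have "x / e = x / (2 * e) + x / (2 * e)" by simp
      ultimately have "x / (2 * e) \<le> a" using False by simp
      then have "1 / (2 * n) * (x / (2 * e)) \<le> p * a"
        using pn' p0 x e by (intro mult_mono) auto
      then have pa: "4 * ga \<le> p * a" by (simp add: ga_def mult_ac)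
      have "\<sigma> \<le> exp (- (p * a))" using power_one_minus_le_exp[of p a] p0 p_small by (simp add: \<sigma>_def)
      also have "\<dots> \<le> exp (- (4 * ga))" using pa by simp
      finally have s1: "\<sigma> \<le> exp (- (4 * ga))" .
      have "0 \<le> e\<^sup>2 * M * h ^ Suc a" using M h by simp
      then have "B' \<le> B + 4 * ga" using B'B by linarith
      also have "\<dots> \<le> B * (1 + 4 * ga)"
        using B1 ga0 mult_right_mono[of 1 B "4 * ga"] by (simp add: algebra_simps)
      also have "\<dots> \<le> B * exp (4 * ga)" using B1 exp_ge_add_one_self by (intro mult_left_mono) auto
      finally have "\<sigma> * B' \<le> \<sigma> * (B * exp (4 * ga))" using \<sigma> by (intro mult_left_mono) auto
      also have "\<dots> \<le> exp (- (4 * ga)) * (B * exp (4 * ga))"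
        using s1 B1 by (intro mult_right_mono) auto
      also have "\<dots> = B" by (simp add: exp_minus)
      finally show ?thesis .
    qed
    have "\<sigma> * bsum m b c (\<lambda>i. W (m - i) (a + i)) \<le> \<sigma> * ((1 - X) * r ^ Suc a) + X * (\<sigma> * B')"
      using mult_left_mono[OF bs \<sigma>(1)] by (simp add: algebra_simps)
    also have "\<dots> \<le> 1 * ((1 - X) * r ^ Suc a) + X * B"
      using \<sigma> \<sigma>B X rj by (intro add_mono mult_right_mono mult_left_mono mult_nonneg_nonneg) auto
    also have "\<dots> = W m (Suc a)"
      by (simp add: W_def B_def X_def s_def algebra_simps)
    finally show ?thesis by (simp add: \<sigma>_def)
  qed
  have "noconf p n 1 \<le> W (n - 1) 1"
  proof (rule noconf_le_supersolution[where n = n])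
    show "1 \<le> W m 0" for m by (simp add: W_def)
  qed (use step p0 p_small n in \<open>auto simp: b_def c_def\<close>)
  also have "W (n - 1) 1 = r + exp (ga * (1 - T)) * ((1 - r) + M * (1 - h))"
    using n by (simp add: W_def of_nat_diff)
  also have "\<dots> \<le> r + (2 * exp (- (x * \<delta> / 16))) * ((1 - r) + 1 * (4 * e))"
  proof (intro add_left_mono mult_mono)
    have "exp (ga * (1 - T)) = exp ga * exp (- (x * \<delta> / 16))"
      using gT by (simp add: exp_add[symmetric] algebra_simps)
    also have "\<dots> \<le> 2 * exp (- (x * \<delta> / 16))"
      using exp_bound_lemma[of ga] ga0 ga1 by (intro mult_right_mono) auto
    finally show "exp (ga * (1 - T)) \<le> 2 * exp (- (x * \<delta> / 16))" .
  qed (use M h r in auto)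
  finally show ?thesis by simp
qed

section \<open>The survival probability and two-sided estimates\<close>

lemma ln_one_minus_bounds:
  fixes y :: real
  assumes "0 \<le> y" "y \<le> 1 / 2"
  shows "y + y\<^sup>2 / 2 \<le> - ln (1 - y)" "- ln (1 - y) \<le> y + y\<^sup>2 / 2 + y ^ 3"
proof -
  define F where "F = (\<lambda>y::real. - ln (1 - y) - y - y\<^sup>2 / 2)"
  define G where "G = (\<lambda>y::real. y + y\<^sup>2 / 2 + y ^ 3 + ln (1 - y))"
  have "F 0 \<le> F y"
  proof (rule DERIV_nonneg_imp_nondecreasing[where f = F])
    fix z assume z: "0 \<le> z" "z \<le> y"
    have "(F has_real_derivative z\<^sup>2 / (1 - z)) (at z)"
      unfolding F_def using z assms
      by (auto intro!: derivative_eq_intros simp: field_simps power2_eq_square)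
    moreover have "0 \<le> z\<^sup>2 / (1 - z)" using z assms by simp
    ultimately show "\<exists>d. (F has_real_derivative d) (at z) \<and> 0 \<le> d" by blast
  qed (use assms in simp)
  then show "y + y\<^sup>2 / 2 \<le> - ln (1 - y)" by (simp add: F_def)
  have "G 0 \<le> G y"
  proof (rule DERIV_nonneg_imp_nondecreasing[where f = G])
    fix z assume z: "0 \<le> z" "z \<le> y"
    have "(G has_real_derivative z\<^sup>2 * (2 - 3 * z) / (1 - z)) (at z)"
      unfolding G_def using z assms
      by (auto intro!: derivative_eq_intros simp: field_simps power2_eq_square)
    moreover have "0 \<le> z\<^sup>2 * (2 - 3 * z) / (1 - z)" using z assms by simp
    ultimately show "\<exists>d. (G has_real_derivative d) (at z) \<and> 0 \<le> d" by blast
  qed (use assms in simp)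
  then show "- ln (1 - y) \<le> y + y\<^sup>2 / 2 + y ^ 3" by (simp add: G_def)
qed

text \<open>The equation for \<theta> says that this quotient at \<theta> equals e / \<theta>. As a
  power series it is the sum of y^(k-2) / k over k from 2 on, with nonnegative coefficients.
  Monotonicity gives global information where a local expansion would not.\<close>

lemma ln_one_minus_quotient_mono:
  fixes y z :: real
  assumes "0 < y" "y \<le> z" "z < 1"
  shows "(- ln (1 - y) - y) / y\<^sup>2 \<le> (- ln (1 - z) - z) / z\<^sup>2"
proof (rule DERIV_nonneg_imp_nondecreasing[where f = "\<lambda>w. (- ln (1 - w) - w) / w\<^sup>2"])
  fix w assume w: "y \<le> w" "w \<le> z"
  define P where "P = (\<lambda>w::real. w\<^sup>2 / (1 - w) + 2 * ln (1 - w) + 2 * w)"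
  have "P 0 \<le> P w"
  proof (rule DERIV_nonneg_imp_nondecreasing[where f = P])
    fix v assume v: "0 \<le> v" "v \<le> w"
    then have v1: "1 - v > 0" using w assms by simp
    then have "(P has_real_derivative (2 * v * (1 - v) + v\<^sup>2) / (1 - v)\<^sup>2 - 2 / (1 - v) + 2) (at v)"
      unfolding P_def
      by (auto intro!: derivative_eq_intros simp: power2_eq_square)
    moreover have "(2 * v * (1 - v) + v\<^sup>2) / (1 - v)\<^sup>2 - 2 / (1 - v) + 2 = v\<^sup>2 / (1 - v)\<^sup>2"
    proof -
      have "(2 * (1 - u) * u + (1 - u)\<^sup>2) / u\<^sup>2 - 2 / u + 2 = (1 - u)\<^sup>2 / u\<^sup>2"
        if "u \<noteq> 0" for u :: real
        using that by (simp add: field_simps power2_eq_square)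
      from this[of "1 - v"] v1 show ?thesis by simp
    qed
    ultimately show "\<exists>d. (P has_real_derivative d) (at v) \<and> 0 \<le> d"
      by (intro exI[of _ "v\<^sup>2 / (1 - v)\<^sup>2"]) auto
  qed (use w assms in simp)
  then have P: "0 \<le> P w" by (simp add: P_def)
  have w0: "0 < w" "0 < 1 - w" using w assms by auto
  have "((\<lambda>w. (- ln (1 - w) - w) / w\<^sup>2) has_real_derivative
      ((1 / (1 - w) - 1) * w\<^sup>2 - (- ln (1 - w) - w) * (2 * w)) / (w\<^sup>2 * w\<^sup>2)) (at w)"
    using w0 by (auto intro!: derivative_eq_intros simp: power2_eq_square)
  moreover have "(1 / (1 - w) - 1) * w\<^sup>2 - (- ln (1 - w) - w) * (2 * w) = w * P w"
    using w0 by (simp add: P_def field_simps power2_eq_square)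
  ultimately have "((\<lambda>w. (- ln (1 - w) - w) / w\<^sup>2) has_real_derivative
      w * P w / (w\<^sup>2 * w\<^sup>2)) (at w)" by simp
  moreover have "0 \<le> w * P w / (w\<^sup>2 * w\<^sup>2)" using P w0 by simp
  ultimately show "\<exists>d. ((\<lambda>w. (- ln (1 - w) - w) / w\<^sup>2) has_real_derivative d) (at w) \<and> 0 \<le> d"
    by blast
qed (use assms in simp)

lemma survival_root_bounds:
  fixes e \<theta> :: real
  assumes e: "0 < e" "e \<le> 1 / 100" and \<theta>: "0 < \<theta>" "\<theta> < 1" "1 - \<theta> = exp (- (1 + e) * \<theta>)"
  shows "3 / 2 * e \<le> \<theta>" "\<theta> \<le> 2 * e" "2 * e - 8 * e\<^sup>2 \<le> \<theta>"
proof -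
  have "ln (1 - \<theta>) = - ((1 + e) * \<theta>)" unfolding \<theta>(3) by (simp add: algebra_simps)
  then have ln: "- ln (1 - \<theta>) = \<theta> + e * \<theta>" by (simp add: algebra_simps)
  \<comment> \<open>The logarithmic bounds hold only up to 1/2, so a large root has to be excluded
    first: beyond 1/2 the quotient is at least 1/2, but e / \<theta> is at most 2 e.\<close>
  have "\<theta> \<le> 1 / 2"
  proof (rule ccontr)
    assume "\<not> \<theta> \<le> 1 / 2"
    then have "(- ln (1 - 1 / 2) - 1 / 2) / (1 / 2)\<^sup>2 \<le> (- ln (1 - \<theta>) - \<theta>) / \<theta>\<^sup>2"
      using \<theta> by (intro ln_one_minus_quotient_mono) auto
    moreover have "(1 / 2 :: real) + (1 / 2)\<^sup>2 / 2 \<le> - ln (1 - 1 / 2)"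
      by (intro ln_one_minus_bounds) auto
    ultimately have "1 / 2 \<le> e * \<theta> / \<theta>\<^sup>2" by (simp add: ln power2_eq_square)
    moreover have "e * \<theta> / \<theta>\<^sup>2 = e / \<theta>" by (simp add: power2_eq_square)
    moreover have "e / \<theta> \<le> e / (1 / 2)"
      using e \<theta> \<open>\<not> \<theta> \<le> 1 / 2\<close> by (intro divide_left_mono) auto
    ultimately show False using e by simp
  qed
  then have "\<theta> + \<theta>\<^sup>2 / 2 \<le> \<theta> + e * \<theta>" "\<theta> + e * \<theta> \<le> \<theta> + \<theta>\<^sup>2 / 2 + \<theta> ^ 3"
    unfolding ln[symmetric] using \<theta>(1) by (auto intro: ln_one_minus_bounds)
  then have "\<theta> * (\<theta> / 2) \<le> \<theta> * e" "\<theta> * e \<le> \<theta> * (\<theta> / 2 + \<theta> * \<theta>)"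
    by (simp_all add: power2_eq_square power3_eq_cube algebra_simps)
  then have 1: "\<theta> \<le> 2 * e" "e \<le> \<theta> / 2 + \<theta> * \<theta>" using \<theta> by auto
  have "\<theta> * \<theta> \<le> (2 * e) * (2 * e)" using 1 \<theta> by (intro mult_mono) auto
  then have 2: "\<theta> * \<theta> \<le> 4 * (e * e)" by simp
  have 3: "e * e \<le> 1 / 100 * e" using e by (intro mult_right_mono) auto
  show "\<theta> \<le> 2 * e" by (rule 1)
  show "3 / 2 * e \<le> \<theta>" using 1(2) 2 3 e by linarith
  show "2 * e - 8 * e\<^sup>2 \<le> \<theta>" using 1(2) 2 unfolding power2_eq_square by linarith
qed

text \<open>Lets \<open>1 - \<gamma> \<theta>\<close> replace the extinction probability at the reduced drift \<open>\<gamma> e\<close>.\<close>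

lemma survival_root_scale:
  fixes e \<theta> \<gamma> :: real
  assumes \<theta>: "0 < \<theta>" "\<theta> < 1" "1 - \<theta> = exp (- (1 + e) * \<theta>)" and \<gamma>: "0 < \<gamma>" "\<gamma> \<le> 1"
  shows "exp (- ((1 + \<gamma> * e) * (\<gamma> * \<theta>))) \<le> 1 - \<gamma> * \<theta>"
proof -
  have "ln (1 - \<theta>) = - ((1 + e) * \<theta>)" unfolding \<theta>(3) by (simp add: algebra_simps)
  then have ln: "- ln (1 - \<theta>) - \<theta> = e * \<theta>" by (simp add: algebra_simps)
  have \<gamma>\<theta>: "\<gamma> * \<theta> \<le> \<theta>" "\<gamma> * \<theta> < 1"
  proof -
    have "\<gamma> * \<theta> \<le> 1 * \<theta>" using \<gamma> \<theta>(1) by (intro mult_right_mono) auto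
    then show "\<gamma> * \<theta> \<le> \<theta>" "\<gamma> * \<theta> < 1" using \<theta>(2) by linarith+
  qed
  have "(- ln (1 - \<gamma> * \<theta>) - \<gamma> * \<theta>) / (\<gamma> * \<theta>)\<^sup>2 \<le> (- ln (1 - \<theta>) - \<theta>) / \<theta>\<^sup>2"
    using \<gamma> \<theta>(1,2) \<gamma>\<theta> by (intro ln_one_minus_quotient_mono) auto
  then have "- ln (1 - \<gamma> * \<theta>) - \<gamma> * \<theta> \<le> (e * \<theta>) / \<theta>\<^sup>2 * (\<gamma> * \<theta>)\<^sup>2"
    unfolding ln using \<gamma> \<theta>(1,2) by (subst (asm) divide_le_eq) auto
  also have "\<dots> = \<gamma> * e * (\<gamma> * \<theta>)" using \<theta>(1) by (simp add: power2_eq_square)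
  finally have "- ((1 + \<gamma> * e) * (\<gamma> * \<theta>)) \<le> ln (1 - \<gamma> * \<theta>)" by (simp add: algebra_simps)
  then have "exp (- ((1 + \<gamma> * e) * (\<gamma> * \<theta>))) \<le> exp (ln (1 - \<gamma> * \<theta>))" by (subst exp_le_cancel_iff)
  also have "\<dots> = 1 - \<gamma> * \<theta>" using \<gamma>\<theta> by simp
  finally show ?thesis .
qed

section \<open>Two-sided estimates governed by \<open>n * e ^ 3\<close>\<close>

lemma subcritical_upper:
  fixes e p :: real
  assumes e: "0 < e" "e < 1" and n: "1 \<le> n" and p: "p = (1 - e) / (2 * real n)"
  shows "1 - noconf p n 1 \<le> 1 / (4 * real n * e\<^sup>2)"
proof -
  have n0: "0 < real n" using n by simp
  have p0: "0 < p" using e n0 by (simp add: p)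
  have np: "2 * (n * p) = 1 - e" using n0 by (simp add: p)
  have "p * 1 \<le> p * n" using n p0 by (intro mult_left_mono) auto
  then have p1: "p \<le> 1 / 2" using np e by (simp add: mult.commute)
  have t: "1 - p\<^sup>2 = (1 - p)\<^sup>2 + 2 * p * (1 - p) * 1" by (simp add: power2_eq_square algebra_simps)
  \<comment> \<open>Without tilt and with d = e, the factor 1 + e meets the 1 - e inside
    \<open>p\<close>. The product 1 - e^2 is below 1, so the leading term is an upper bound with no
    error term at all.\<close>
  have "1 * (1 - p * (1 + e) / (2 * e\<^sup>2)) \<le> noconf p n 1"
  proof (rule noconf_ge[OF _ _ _ _ _ _ n t])
    have "1 + real n * (- p\<^sup>2) \<le> (1 + (- p\<^sup>2)) ^ n"
      using p0 p1 power_le_one[of p 2] by (intro Bernoulli_inequality) auto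
    moreover have "p * (n * p) \<le> p * 1" using np e p0 by (intro mult_left_mono) auto
    ultimately show "1 * (1 - p) \<le> (1 - p\<^sup>2) ^ n" by (simp add: power2_eq_square algebra_simps)
    have "n * (2 * p * (1 - p) * 1) = (2 * (n * p)) * (1 - p)" by simp
    also have "\<dots> = (1 - e) * (1 - p)" unfolding np ..
    also have "\<dots> \<le> (1 - e) * (1 - p\<^sup>2)"
      using e p0 p1 by (intro mult_left_mono) (auto simp: power2_eq_square mult_left_le)
    finally show "n * (2 * p * (1 - p) * 1) \<le> (1 - e) * (1 - p\<^sup>2)" .
  qed (use p0 p1 e in auto)
  moreover have "p * (1 + e) / (2 * e\<^sup>2) = (1 - e\<^sup>2) / (4 * real n * e\<^sup>2)"
    by (simp add: p power2_eq_square algebra_simps)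
  moreover have "\<dots> \<le> 1 / (4 * real n * e\<^sup>2)" by (intro divide_right_mono) auto
  ultimately show ?thesis by simp
qed

text \<open>Tilting by 1 - \<theta> turns the supercritical walk into a subcritical one. The excess
  over \<theta> is its accumulated killing, of order 1 / (n e^2), hence of relative order 1 / (n
  e^3). A sharp tilted drift would improve only the constant, so d = e/2, which follows from
  \<theta> being at least 3 e / 2, is enough.\<close>

lemma supercritical_upper:
  fixes e p \<theta> :: real
  assumes e: "0 < e" "e \<le> 1 / 100" and n: "1 \<le> n" and p: "p = (1 + e) / (2 * real n)"
    and L: "1 \<le> n * e ^ 3" and \<theta>: "0 < \<theta>" "\<theta> < 1" "1 - \<theta> = exp (- (1 + e) * \<theta>)"
  shows "1 - noconf p n 1 \<le> \<theta> * (1 + 3 / (n * e ^ 3))"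
proof -
  note tb = survival_root_bounds[OF e \<theta>]
  have n0: "0 < real n" using n by simp
  have p0: "0 < p" using e n0 by (simp add: p)
  have np: "2 * (n * p) = 1 + e" using n0 by (simp add: p)
  have pn: "p \<le> 1 / n" using e n0 by (simp add: p field_simps)
  have "1 / n \<le> e ^ 3" using L n0 by (simp add: divide_le_eq mult.commute)
  also have "e ^ 3 \<le> e" using e power_decreasing[of 1 3 e] by simp
  finally have p1: "p \<le> 1 / 100" using pn e by simp
  define r0 where "r0 = p\<^sup>2 + 2 * p * (1 - p) * \<theta>"
  have t: "1 - r0 = (1 - p)\<^sup>2 + 2 * p * (1 - p) * (1 - \<theta>)"
    by (simp add: r0_def power2_eq_square algebra_simps)
  have r00: "0 \<le> r0" using p0 p1 \<theta>(1,2) by (simp add: r0_def)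
  have r01: "r0 \<le> p * (1 / 10)"
  proof -
    have "r0 = p * (p + 2 * ((1 - p) * \<theta>))" by (simp add: r0_def power2_eq_square algebra_simps)
    also have "\<dots> \<le> p * (p + 2 * (1 * \<theta>))"
      using p0 \<theta>(1,2) by (intro mult_left_mono add_left_mono mult_right_mono) auto
    also have "\<dots> \<le> p * (1 / 10)" using p0 p1 tb e by (intro mult_left_mono) auto
    finally show ?thesis .
  qed
  define d where "d = e / 2"
  have "(1 - \<theta>) * (1 - p * (1 + d) / (2 * d\<^sup>2)) \<le> noconf p n 1"
  proof (rule noconf_ge[OF _ _ _ _ _ _ n t])
    \<comment> \<open>The extra \<open>p\<close> on the right is the factor 1 - p granted by
      \<open>root\<close>; it absorbs the p^2 in \<open>r0\<close> and the second-order term of the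
      logarithm.\<close>
    have "n * (r0 + 2 * r0\<^sup>2) \<le> (1 + e) * \<theta> + p"
    proof -
      have "r0 * r0 \<le> (p * (1 / 10)) * (p * (1 / 10))" using r00 r01 by (intro mult_mono) auto
      then have "n * (r0 * r0) \<le> n * ((p * (1 / 10)) * (p * (1 / 10)))" by (intro mult_left_mono) auto
      also have "\<dots> = p * (2 * (n * p)) / 200" by simp
      finally have 1: "n * (r0 * r0) \<le> p * (1 + e) / 200" unfolding np .
      have "n * r0 = p * (2 * (n * p)) / 2 + (2 * (n * p)) * ((1 - p) * \<theta>)"
        by (simp add: r0_def power2_eq_square algebra_simps)
      then have "n * r0 = p * (1 + e) / 2 + (1 + e) * ((1 - p) * \<theta>)" unfolding np .
      also have "\<dots> \<le> p * (1 + e) / 2 + (1 + e) * (1 * \<theta>)"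
        using e p0 \<theta>(1,2) by (intro add_left_mono mult_left_mono mult_right_mono) auto
      finally have 2: "n * r0 \<le> p * (1 + e) / 2 + (1 + e) * \<theta>" by simp
      have 3: "p * (1 + e) \<le> p * (101 / 100)" using e p0 by (intro mult_left_mono) auto
      have "n * (r0 + 2 * r0\<^sup>2) = n * r0 + 2 * (n * (r0 * r0))"
        by (simp add: power2_eq_square algebra_simps)
      then show ?thesis using 1 2 3 p0 by linarith
    qed
    then have 1: "exp (- ((1 + e) * \<theta> + p)) \<le> exp (- (n * (r0 + 2 * r0\<^sup>2)))" by simp
    have "(1 - \<theta>) * (1 - p) \<le> (1 - \<theta>) * exp (- p)"
      using \<theta>(1,2) exp_ge_add_one_self[of "- p"] by (intro mult_left_mono) auto
    also have "\<dots> = exp (- ((1 + e) * \<theta> + p))" unfolding \<theta>(3) exp_add[symmetric] by (simp add: algebra_simps)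
    also note 1
    also have "exp (- (n * (r0 + 2 * r0\<^sup>2))) \<le> (1 - r0) ^ n"
      using r00 r01 p1 by (intro exp_le_power_one_minus) auto
    finally show "(1 - \<theta>) * (1 - p) \<le> (1 - r0) ^ n" .
    have "n * (2 * p * (1 - p) * (1 - \<theta>)) = (2 * (n * p)) * (1 - \<theta>) * (1 - p)" by simp
    also have "\<dots> = (1 + e) * (1 - \<theta>) * (1 - p)" unfolding np ..
    also have "\<dots> \<le> (1 - d) * (1 - p)"
    proof (rule mult_right_mono)
      have "(1 + e) * (1 - \<theta>) = 1 + e - \<theta> - e * \<theta>" by (simp add: algebra_simps)
      moreover have "0 \<le> e * \<theta>" using e \<theta>(1,2) by simp
      ultimately show "(1 + e) * (1 - \<theta>) \<le> 1 - d" using tb(1) unfolding d_def by linarith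
    qed (use p1 in simp)
    also have "\<dots> \<le> (1 - d) * (1 - r0)"
      using r01 p0 e by (intro mult_left_mono) (auto simp: d_def)
    finally show "n * (2 * p * (1 - p) * (1 - \<theta>)) \<le> (1 - d) * (1 - r0)" .
  qed (use p0 p1 e \<theta>(1,2) in \<open>auto simp: d_def\<close>)
  then have "1 - noconf p n 1 \<le> 1 - (1 - \<theta>) * (1 - p * (1 + d) / (2 * d\<^sup>2))" by simp
  also have "\<dots> = \<theta> + (1 - \<theta>) * (p * (1 + d) / (2 * d\<^sup>2))" by (simp add: algebra_simps)
  also have "\<dots> \<le> \<theta> + 1 * (p * (1 + d) / (2 * d\<^sup>2))"
    using \<theta>(1,2) p0 e by (intro add_left_mono mult_right_mono) (auto simp: d_def)
  also have "\<dots> = \<theta> + ((1 + e) * (1 + d)) * (1 / (n * e\<^sup>2))"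
  proof -
    have "2 * d\<^sup>2 = e\<^sup>2 / 2" by (simp add: d_def power2_eq_square)
    then show ?thesis by (simp add: p)
  qed
  also have "\<dots> \<le> \<theta> + 3 * (1 / (n * e\<^sup>2))"
  proof (intro add_left_mono mult_right_mono)
    have "(1 + e) * (1 + d) \<le> (1 + 1 / 2) * (1 + 1)" using e by (intro mult_mono) (auto simp: d_def)
    then show "(1 + e) * (1 + d) \<le> 3" by simp
  qed simp
  also have "3 * (1 / (n * e\<^sup>2)) = e * (3 / (n * e ^ 3))"
    using e by (simp add: power2_eq_square power3_eq_cube)
  also have "\<dots> \<le> \<theta> * (3 / (n * e ^ 3))"
    using e tb by (intro mult_right_mono) auto
  finally show ?thesis by (simp add: algebra_simps)
qed

lemma mult_one_minus_ge:
  fixes a b :: real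
  assumes "0 \<le> a" "0 \<le> b"
  shows "1 - a - b \<le> (1 - a) * (1 - b)"
  using assms by (simp add: algebra_simps)

lemma subcritical_lower:
  fixes \<eta> :: real
  assumes \<eta>: "0 < \<eta>" "\<eta> \<le> 1"
  shows "\<exists>\<Lambda> e1. 0 < e1 \<and> (\<forall>n e. 1 \<le> n \<longrightarrow> 0 < e \<longrightarrow> e \<le> e1 \<longrightarrow> \<Lambda> \<le> real n * e ^ 3 \<longrightarrow>
    (1 - \<eta>) / (4 * real n * e\<^sup>2) \<le> 1 - noconf ((1 - e) / (2 * real n)) n 1)"
proof -
  \<comment> \<open>The error budget: 6 \<delta> from the two squared factors, \<eta>/20 from
    \<open>4 * e'\<close>, \<eta>/16 from the exponential term (hence 2048 = 128 * 16 in
    \<open>x\<close>) and \<open>e1\<close> from 1 - e. The sum stays below \<eta>. The value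
    \<delta> also serves as the accuracy \<eta> of \<open>noconf_le_subcritical\<close>.\<close>
  define \<delta> where "\<delta> = \<eta> / 16"
  define x where "x = max 1 (8 * ln (2048 / \<eta>))"
  define e1 where "e1 = \<eta> / 100"
  have \<delta>: "0 < \<delta>" "\<delta> \<le> 1 / 8" "\<delta> \<le> 1" using \<eta> by (auto simp: \<delta>_def)
  have x: "1 \<le> x" "128 * exp (- x / 8) \<le> \<eta> / 16"
  proof -
    have "- x / 8 \<le> - ln (2048 / \<eta>)" by (simp add: x_def)
    then have "exp (- x / 8) \<le> exp (- ln (2048 / \<eta>))" by (subst exp_le_cancel_iff)
    also have "\<dots> = \<eta> / 2048" using \<eta> by (simp add: exp_minus)
    finally show "128 * exp (- x / 8) \<le> \<eta> / 16" by simp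
  qed (simp add: x_def)
  show ?thesis
  proof (rule exI[of _ "2 * x\<^sup>2 / (\<delta> * \<delta>)"], rule exI[of _ e1], intro conjI allI impI)
    show "0 < e1" using \<eta> by (simp add: e1_def)
  next
    fix n :: nat and e :: real
    assume n: "1 \<le> n" and e: "0 < e" "e \<le> e1" and L: "2 * x\<^sup>2 / (\<delta> * \<delta>) \<le> n * e ^ 3"
    define p where "p = (1 - e) / (2 * real n)"
    define e' where "e' = e * (1 + 2 * \<delta>)"
    have e100: "e \<le> 1 / 100" using e \<eta> by (simp add: e1_def)
    have bound: "noconf p n 1 \<le> 1 - p / (2 * e\<^sup>2) *
      ((1 - \<delta>)\<^sup>2 * (1 - 4 * e') / (1 + 2 * \<delta>)\<^sup>2 - 128 * exp (- x / 8))"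
      using noconf_le_subcritical[OF e(1) e100 \<delta>(1,2,1,3) x(1) n p_def L e'_def] .
    have "1 - \<eta> \<le> (1 - e) * ((1 - \<delta>)\<^sup>2 * (1 - 4 * e') / (1 + 2 * \<delta>)\<^sup>2 - 128 * exp (- x / 8))"
    proof -
      have e'1: "4 * e' \<le> \<eta> / 20" "0 \<le> 4 * e'"
      proof -
        have "e * (1 + 2 * \<delta>) \<le> (\<eta> / 100) * (5 / 4)" using e \<delta> by (intro mult_mono) (auto simp: e1_def)
        then show "4 * e' \<le> \<eta> / 20" by (simp add: e'_def)
        show "0 \<le> 4 * e'" using e \<delta> by (simp add: e'_def)
      qed
      have 1: "1 - 2 * \<delta> \<le> (1 - \<delta>)\<^sup>2" using mult_one_minus_ge[of \<delta> \<delta>] \<delta> by (simp add: power2_eq_square)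
      have "1 - 2 * \<delta> - \<eta> / 20 \<le> (1 - 2 * \<delta>) * (1 - 4 * e')"
        using mult_one_minus_ge[of "2 * \<delta>" "4 * e'"] e'1 \<delta> by simp
      also have "\<dots> \<le> (1 - \<delta>)\<^sup>2 * (1 - 4 * e')" using 1 e'1 \<eta> by (intro mult_right_mono) auto
      finally have 2: "1 - (2 * \<delta> + \<eta> / 20) \<le> (1 - \<delta>)\<^sup>2 * (1 - 4 * e')" by simp
      have 3: "1 - 4 * \<delta> \<le> 1 / (1 + 2 * \<delta>)\<^sup>2"
      proof -
        have "(1 - 4 * \<delta>) * (1 + 2 * \<delta>)\<^sup>2 = 1 - 12 * (\<delta> * \<delta>) - 16 * (\<delta> * \<delta> * \<delta>)"
          by (simp add: power2_eq_square algebra_simps)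
        also have "\<dots> \<le> 1"
        proof -
          have "0 \<le> \<delta> * \<delta>" "0 \<le> \<delta> * \<delta> * \<delta>" using \<delta> by auto
          then show ?thesis by linarith
        qed
        finally show ?thesis using \<delta> by (simp add: le_divide_eq)
      qed
      have "1 - (2 * \<delta> + \<eta> / 20) - 4 * \<delta> \<le> (1 - (2 * \<delta> + \<eta> / 20)) * (1 - 4 * \<delta>)"
        using \<delta> \<eta> by (intro mult_one_minus_ge) auto
      also have "\<dots> \<le> ((1 - \<delta>)\<^sup>2 * (1 - 4 * e')) * (1 / (1 + 2 * \<delta>)\<^sup>2)"
        using 2 3 \<delta> \<eta> by (intro mult_mono) (auto simp: \<delta>_def)
      finally have 4: "1 - 6 * \<delta> - \<eta> / 20 - \<eta> / 16
          \<le> (1 - \<delta>)\<^sup>2 * (1 - 4 * e') / (1 + 2 * \<delta>)\<^sup>2 - 128 * exp (- x / 8)"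
        using x by simp
      have "1 - \<eta> \<le> 1 - e - (6 * \<delta> + \<eta> / 20 + \<eta> / 16)"
        using e \<eta> by (simp add: \<delta>_def e1_def)
      also have "\<dots> \<le> (1 - e) * (1 - (6 * \<delta> + \<eta> / 20 + \<eta> / 16))"
        using e \<delta> \<eta> by (intro mult_one_minus_ge) auto
      also have "\<dots> \<le> (1 - e) * ((1 - \<delta>)\<^sup>2 * (1 - 4 * e') / (1 + 2 * \<delta>)\<^sup>2 - 128 * exp (- x / 8))"
        using 4 e100 by (intro mult_left_mono) auto
      finally show ?thesis .
    qed
    then have "(1 - \<eta>) / (4 * real n * e\<^sup>2) \<le> (1 - e) * ((1 - \<delta>)\<^sup>2 * (1 - 4 * e') / (1 + 2 * \<delta>)\<^sup>2
        - 128 * exp (- x / 8)) / (4 * real n * e\<^sup>2)"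
      by (intro divide_right_mono) auto
    also have "\<dots> = p / (2 * e\<^sup>2) * ((1 - \<delta>)\<^sup>2 * (1 - 4 * e') / (1 + 2 * \<delta>)\<^sup>2 - 128 * exp (- x / 8))"
      by (simp add: p_def)
    also have "\<dots> \<le> 1 - noconf p n 1" using bound by linarith
    finally show "(1 - \<eta>) / (4 * real n * e\<^sup>2) \<le> 1 - noconf ((1 - e) / (2 * real n)) n 1"
      by (simp add: p_def)
  qed
qed

lemma supercritical_lower:
  fixes \<eta> :: real
  assumes \<eta>: "0 < \<eta>" "\<eta> \<le> 1 / 2"
  shows "\<exists>\<Lambda>. \<forall>n e \<theta>. 1 \<le> n \<longrightarrow> 0 < e \<longrightarrow> e \<le> 1 / 100 \<longrightarrow> \<Lambda> \<le> real n * e ^ 3 \<longrightarrow>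
    0 < \<theta> \<longrightarrow> \<theta> < 1 \<longrightarrow> 1 - \<theta> = exp (- (1 + e) * \<theta>) \<longrightarrow>
    (1 - \<eta>) * \<theta> \<le> 1 - noconf ((1 + e) / (2 * real n)) n 1"
proof -
  \<comment> \<open>Half of the loss \<eta> \<theta> is 3 \<delta> \<theta>, from replacing \<theta>
    by \<gamma> \<theta>. The other half is 2 (\<eta>/20) (5 \<theta>), where 5 \<theta> dominates
    \<gamma> \<theta> + 4 e.\<close>
  define \<delta> where "\<delta> = \<eta> / 6"
  define x where "x = max 1 (16 / \<delta> * ln (20 / \<eta>))"
  have \<delta>: "0 < \<delta>" "\<delta> \<le> 1 / 8" using \<eta> by (auto simp: \<delta>_def)
  have x: "1 \<le> x" "exp (- (x * \<delta> / 16)) \<le> \<eta> / 20"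
  proof -
    have "16 / \<delta> * ln (20 / \<eta>) \<le> x" by (simp add: x_def)
    then have "16 / \<delta> * ln (20 / \<eta>) * (\<delta> / 16) \<le> x * (\<delta> / 16)" using \<delta> by (intro mult_right_mono) auto
    then have "- (x * \<delta> / 16) \<le> - ln (20 / \<eta>)" using \<delta> by simp
    then have "exp (- (x * \<delta> / 16)) \<le> exp (- ln (20 / \<eta>))" by (subst exp_le_cancel_iff)
    also have "\<dots> = \<eta> / 20" using \<eta> by (simp add: exp_minus)
    finally show "exp (- (x * \<delta> / 16)) \<le> \<eta> / 20" .
  qed (simp add: x_def)
  show ?thesis
  proof (rule exI[of _ "x * exp (4 * x) / \<delta>"], intro allI impI)
    fix n :: nat and e \<theta> :: real
    assume n: "1 \<le> n" and e: "0 < e" "e \<le> 1 / 100" and L: "x * exp (4 * x) / \<delta> \<le> n * e ^ 3"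
      and \<theta>: "0 < \<theta>" "\<theta> < 1" "1 - \<theta> = exp (- (1 + e) * \<theta>)"
    define p where "p = (1 + e) / (2 * real n)"
    define \<gamma> where "\<gamma> = 1 - 3 * \<delta>"
    have \<gamma>: "0 < \<gamma>" "\<gamma> \<le> 1" using \<delta> by (auto simp: \<gamma>_def)
    have g\<theta>: "\<gamma> * \<theta> \<le> \<theta>" "0 < \<gamma> * \<theta>" "\<gamma> * \<theta> < 1"
    proof -
      have "\<gamma> * \<theta> \<le> 1 * \<theta>" using \<gamma> \<theta>(1) by (intro mult_right_mono) auto
      then show "\<gamma> * \<theta> \<le> \<theta>" "\<gamma> * \<theta> < 1" using \<theta>(2) by linarith+
      show "0 < \<gamma> * \<theta>" using \<gamma> \<theta>(1) by simp
    qed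
    have "noconf p n 1 \<le> (1 - \<gamma> * \<theta>)
        + 2 * exp (- (x * \<delta> / 16)) * ((1 - (1 - \<gamma> * \<theta>)) + 4 * e)"
    proof (rule noconf_le_supercritical[OF e \<delta> x(1) n p_def _ _ _ L])
      show "exp (- ((1 + (1 - 3 * \<delta>) * e) * (1 - (1 - \<gamma> * \<theta>)))) \<le> 1 - \<gamma> * \<theta>"
        using survival_root_scale[OF \<theta> \<gamma>] by (simp add: \<gamma>_def)
    qed (use g\<theta> in auto)
    also have "\<dots> \<le> (1 - \<gamma> * \<theta>) + 2 * (\<eta> / 20) * (5 * \<theta>)"
    proof (intro add_left_mono mult_mono[of "2 * _"])
      show "(1 - (1 - \<gamma> * \<theta>)) + 4 * e \<le> 5 * \<theta>"
        using g\<theta>(1) e(1) survival_root_bounds(1)[OF e \<theta>] by linarith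
      show "0 \<le> (1 - (1 - \<gamma> * \<theta>)) + 4 * e"
        using g\<theta>(2) e(1) by linarith
    qed (use x \<eta> in simp_all)
    also have "\<dots> = 1 - (1 - \<eta>) * \<theta>" by (simp add: \<gamma>_def \<delta>_def algebra_simps)
    finally show "(1 - \<eta>) * \<theta> \<le> 1 - noconf ((1 + e) / (2 * real n)) n 1"
      by (simp add: p_def)
  qed
qed

section \<open>Asymptotics in the scaling window\<close>

lemma little_o_on_1I:
  assumes "\<And>z. z \<in> R \<Longrightarrow> \<bar>f z\<bar> \<le> C"
    and "\<And>c. 0 < c \<Longrightarrow> eventually (\<lambda>z. z \<in> R \<longrightarrow> \<bar>f z\<bar> \<le> c) \<F>"
  shows "f \<in> little_o_on \<F> R (\<lambda>_. 1)"
  unfolding little_o_on_def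
proof
  show "f \<in> O[principal R](\<lambda>_. 1)"
    using assms(1) by (intro bigoI[of _ C]) (simp add: eventually_principal)
  show "f \<in> o[inf \<F> (principal R)](\<lambda>_. 1)"
    using assms(2) by (intro landau_o.smallI) (simp add: eventually_inf_principal)
qed

lemma eventually_lambda_large: "eventually (\<lambda>(n, l, x). K \<le> \<bar>l\<bar>) lambda_large"
  unfolding lambda_large_def eventually_filtercomap
  by (intro exI[of _ "\<lambda>y. K \<le> y"]) (auto simp: eventually_ge_at_top)

lemma eventually_eps_small:
  assumes "0 < d"
  shows "eventually (\<lambda>(n, l, x). \<bar>eps n l\<bar> \<le> d) eps_small"
proof -
  have "eventually (\<lambda>y. \<bar>y\<bar> \<le> d) (nhds (0::real))"
    using assms eventually_nhds_metric[of "\<lambda>y. \<bar>y\<bar> \<le> d" "0::real"]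
    by (auto simp: dist_real_def intro!: exI[of _ d])
  then show ?thesis
    unfolding eps_small_def eventually_filtercomap by (intro exI[of _ "\<lambda>y. \<bar>y\<bar> \<le> d"]) auto
qed

lemma regime_facts:
  assumes "(n, l, x) \<in> regime 1 (1 / 100)"
  shows "1 \<le> n" "x \<in> literals n" "\<bar>eps n l\<bar> \<le> 1 / 100" "real n * \<bar>eps n l\<bar> ^ 3 = \<bar>l\<bar> ^ 3"
    "1 \<le> \<bar>l\<bar>" "real n * (eps n l)\<^sup>2 = l\<^sup>2 / (real n powr (-1/3))"
proof -
  have l: "1 \<le> \<bar>l\<bar>" "\<bar>l\<bar> \<le> 1 / 100 * real n powr (1/3)" "x \<in> literals n"
    using assms by (auto simp: regime_def)
  then show n: "1 \<le> n" by (auto simp: literals_def)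
  then have n0: "0 < real n" by simp
  show "x \<in> literals n" "1 \<le> \<bar>l\<bar>" using l by auto
  define w where "w = real n powr (-1/3)"
  have w: "0 < w" using n0 by (simp add: w_def)
  have "w * w * w = real n powr (-1/3 + -1/3 + -1/3)" unfolding w_def by (simp only: powr_add)
  also have "\<dots> = 1 / n" using n0 by (simp add: powr_neg_one)
  finally have w3: "w * w * w * n = 1" using n0 by simp
  have "real n powr (1/3) * w = real n powr (1/3 + -1/3)" unfolding w_def by (simp only: powr_add)
  also have "\<dots> = 1" using n0 by simp
  finally have "1 / 100 * real n powr (1/3) * w = 1 / 100" by simp
  moreover have "\<bar>l\<bar> * w \<le> 1 / 100 * real n powr (1/3) * w" using l w by (intro mult_right_mono) auto
  ultimately have "\<bar>l\<bar> * w \<le> 1 / 100" by linarith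
  moreover have eps: "eps n l = l * w" by (simp add: eps_def w_def)
  moreover have eps': "\<bar>eps n l\<bar> = \<bar>l\<bar> * w" using w by (simp add: eps abs_mult)
  ultimately show "\<bar>eps n l\<bar> \<le> 1 / 100" by simp
  have "real n * \<bar>eps n l\<bar> ^ 3 = \<bar>l\<bar> ^ 3 * (w * w * w * n)"
    unfolding eps' by (simp add: power3_eq_cube mult_ac)
  then show "real n * \<bar>eps n l\<bar> ^ 3 = \<bar>l\<bar> ^ 3" by (simp add: w3)
  have "real n * (eps n l)\<^sup>2 * w = l\<^sup>2 * (w * w * w * n)"
    unfolding eps by (simp add: power2_eq_square mult_ac)
  then have "real n * (eps n l)\<^sup>2 * w = l\<^sup>2" by (simp add: w3)
  then have "real n * (eps n l)\<^sup>2 = l\<^sup>2 / w" using w by (simp add: eq_divide_eq)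
  then show "real n * (eps n l)\<^sup>2 = l\<^sup>2 / (real n powr (-1/3))" by (simp add: w_def)
qed

lemma le_power3:
  fixes y :: real
  assumes "1 \<le> y"
  shows "y \<le> y ^ 3"
  using power_increasing[of 1 3 y] assms by simp

lemma vartheta_root:
  assumes "0 < \<epsilon>"
  shows "0 < vartheta \<epsilon>" "vartheta \<epsilon> < 1" "1 - vartheta \<epsilon> = exp (- (1 + \<epsilon>) * vartheta \<epsilon>)"
  using theI'[OF vartheta_unique[OF assms]] unfolding vartheta_def by auto

lemma sub_regime_facts:
  assumes "(n, l, x) \<in> sub_regime 1 (1 / 100)"
  shows "(n, l, x) \<in> regime 1 (1 / 100)" "0 < \<bar>eps n l\<bar>" "\<bar>eps n l\<bar> \<le> 1 / 100"
    "reach_prob n (edge_prob n l) x = 1 - noconf ((1 - \<bar>eps n l\<bar>) / (2 * real n)) n 1"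
    "real n powr (-1/3) / (4 * l\<^sup>2) = 1 / (4 * real n * \<bar>eps n l\<bar>\<^sup>2)"
    "0 < real n powr (-1/3) / (4 * l\<^sup>2)"
proof -
  show R: "(n, l, x) \<in> regime 1 (1 / 100)" and e: "0 < \<bar>eps n l\<bar>"
    using assms by (auto simp: sub_regime_def)
  have neg: "eps n l < 0" using assms by (auto simp: sub_regime_def)
  note f = regime_facts[OF R]
  show "\<bar>eps n l\<bar> \<le> 1 / 100" by (rule f)
  have n0: "0 < real n" using f by simp
  have p: "edge_prob n l = (1 - \<bar>eps n l\<bar>) / (2 * real n)" using neg by (simp add: edge_prob_def)
  have "0 \<le> edge_prob n l" "edge_prob n l \<le> 1" using f n0 e by (auto simp: p divide_le_eq)
  from reach_prob_eq[OF this f(2)] show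
    "reach_prob n (edge_prob n l) x = 1 - noconf ((1 - \<bar>eps n l\<bar>) / (2 * real n)) n 1"
    by (simp only: p)
  have "4 * real n * \<bar>eps n l\<bar>\<^sup>2 = 4 * (l\<^sup>2 / (real n powr (-1/3)))"
    using f(6) by simp
  then show "real n powr (-1/3) / (4 * l\<^sup>2) = 1 / (4 * real n * \<bar>eps n l\<bar>\<^sup>2)" by simp
  show "0 < real n powr (-1/3) / (4 * l\<^sup>2)" using n0 f(5) by auto
qed

lemma super_regime_facts:
  assumes "(n, l, x) \<in> super_regime 1 (1 / 100)"
  shows "(n, l, x) \<in> regime 1 (1 / 100)" "0 < eps n l" "eps n l \<le> 1 / 100" "real n * eps n l ^ 3 = \<bar>l\<bar> ^ 3"
    "reach_prob n (edge_prob n l) x = 1 - noconf ((1 + eps n l) / (2 * real n)) n 1"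
proof -
  show R: "(n, l, x) \<in> regime 1 (1 / 100)" and e: "0 < eps n l"
    using assms by (auto simp: super_regime_def)
  note f = regime_facts[OF R]
  show "eps n l \<le> 1 / 100" "real n * eps n l ^ 3 = \<bar>l\<bar> ^ 3" using f(3,4) e by auto
  have p: "edge_prob n l = (1 + eps n l) / (2 * real n)" by (simp add: edge_prob_def)
  have "0 \<le> edge_prob n l" "edge_prob n l \<le> 1" using f e by (auto simp: p divide_le_eq)
  from reach_prob_eq[OF this f(2)] show
    "reach_prob n (edge_prob n l) x = 1 - noconf ((1 + eps n l) / (2 * real n)) n 1"
    by (simp only: p)
qed

lemma subcritical_case:
  defines "\<delta> \<equiv> \<lambda>(n, l, x). reach_prob n (edge_prob n l) x / (real n powr (-1/3) / (4 * l\<^sup>2)) - 1"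
  shows "\<delta> \<in> little_o_on (inf lambda_large eps_small) (sub_regime 1 (1 / 100)) (\<lambda>_. 1)"
proof (rule little_o_on_1I[where C = 1])
  \<comment> \<open>The ratio lies in [0, 1] on the whole regime, which gives uniform boundedness.
    Only its lower bound needs the limits, and it needs both: \<open>subcritical_lower\<close> asks
    for large n e^3 and for e below a threshold depending on the accuracy.\<close>
  have le: "reach_prob n (edge_prob n l) x / (real n powr (-1/3) / (4 * l\<^sup>2)) \<le> 1"
    and ge: "0 \<le> reach_prob n (edge_prob n l) x / (real n powr (-1/3) / (4 * l\<^sup>2))"
    if z: "(n, l, x) \<in> sub_regime 1 (1 / 100)" for n l x
  proof -
    note f = sub_regime_facts[OF z] and g = regime_facts[OF sub_regime_facts(1)[OF z]]
    have "reach_prob n (edge_prob n l) x \<le> real n powr (-1/3) / (4 * l\<^sup>2)"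
      unfolding f(4,5) using f(2,3) g(1) by (intro subcritical_upper) auto
    then show "reach_prob n (edge_prob n l) x / (real n powr (-1/3) / (4 * l\<^sup>2)) \<le> 1"
      using f(6) by (simp only: divide_le_eq_1_pos)
    show "0 \<le> reach_prob n (edge_prob n l) x / (real n powr (-1/3) / (4 * l\<^sup>2))"
      using f(6) by (intro divide_nonneg_pos) (auto simp: reach_prob_def)
  qed
  show "\<bar>\<delta> z\<bar> \<le> 1" if "z \<in> sub_regime 1 (1 / 100)" for z
    using le ge that by (cases z) (auto simp: \<delta>_def abs_le_iff)
  fix c :: real assume c: "0 < c"
  define \<eta> where "\<eta> = min c 1"
  have \<eta>: "0 < \<eta>" "\<eta> \<le> 1" "\<eta> \<le> c" using c by (auto simp: \<eta>_def)
  obtain \<Lambda> e1 where e1: "0 < e1" and low: "\<forall>n e. 1 \<le> n \<longrightarrow> 0 < e \<longrightarrow> e \<le> e1 \<longrightarrow> \<Lambda> \<le> real n * e ^ 3 \<longrightarrow>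
    (1 - \<eta>) / (4 * real n * e\<^sup>2) \<le> 1 - noconf ((1 - e) / (2 * real n)) n 1"
    using subcritical_lower[OF \<eta>(1,2)] by blast
  have "eventually (\<lambda>(n, l, x). \<Lambda> \<le> \<bar>l\<bar>) (inf lambda_large eps_small)"
    "eventually (\<lambda>(n, l, x). \<bar>eps n l\<bar> \<le> e1) (inf lambda_large eps_small)"
    using eventually_lambda_large eventually_eps_small[OF e1]
    by (auto intro: filter_leD[OF inf_le1] filter_leD[OF inf_le2])
  then show "eventually (\<lambda>z. z \<in> sub_regime 1 (1 / 100) \<longrightarrow> \<bar>\<delta> z\<bar> \<le> c) (inf lambda_large eps_small)"
  proof eventually_elim
    case (elim z)
    show ?case
    proof
      obtain n l x where z: "z = (n, l, x)" by (cases z)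
      assume "z \<in> sub_regime 1 (1 / 100)"
      then have zR: "(n, l, x) \<in> sub_regime 1 (1 / 100)" by (simp add: z)
      note f = sub_regime_facts[OF zR] and g = regime_facts[OF sub_regime_facts(1)[OF zR]]
      have "\<Lambda> \<le> real n * \<bar>eps n l\<bar> ^ 3"
        using elim(1) le_power3[OF g(5)] by (simp add: z g(4))
      then have "(1 - \<eta>) / (4 * real n * \<bar>eps n l\<bar>\<^sup>2) \<le> reach_prob n (edge_prob n l) x"
        unfolding f(4) using elim(2) f(2) g(1) by (intro low[rule_format]) (auto simp: z)
      then have "(1 - \<eta>) * (real n powr (-1/3) / (4 * l\<^sup>2)) \<le> reach_prob n (edge_prob n l) x"
        unfolding f(5) by simp
      then have "1 - \<eta> \<le> reach_prob n (edge_prob n l) x / (real n powr (-1/3) / (4 * l\<^sup>2))"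
        using f(6) by (simp only: pos_le_divide_eq)
      then show "\<bar>\<delta> z\<bar> \<le> c" using le[OF zR] \<eta> c by (auto simp: \<delta>_def z abs_le_iff)
    qed
  qed
qed

text \<open>Measured against \<open>vartheta\<close>, all estimates hold for every e up to 1/100, so
  the single limit \<open>lambda_large\<close> suffices. Boundedness and convergence are stated
  separately because both are transferred to a second error term in the final theorem.\<close>

lemma supercritical_case:
  defines "\<delta> \<equiv> \<lambda>(n, l, x). reach_prob n (edge_prob n l) x / vartheta (eps n l) - 1"
  shows "z \<in> super_regime 1 (1 / 100) \<Longrightarrow> \<bar>\<delta> z\<bar> \<le> 3"
    and "0 < c \<Longrightarrow> eventually (\<lambda>z. z \<in> super_regime 1 (1 / 100) \<longrightarrow> \<bar>\<delta> z\<bar> \<le> c) lambda_large"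
proof -
  have le: "reach_prob n (edge_prob n l) x / vartheta (eps n l) \<le> 1 + 3 / \<bar>l\<bar>"
    and ge: "0 \<le> reach_prob n (edge_prob n l) x / vartheta (eps n l)"
    if z: "(n, l, x) \<in> super_regime 1 (1 / 100)" for n l x
  proof -
    note f = super_regime_facts[OF z] and g = regime_facts[OF super_regime_facts(1)[OF z]]
    note \<theta> = vartheta_root[OF f(2)]
    have l3: "\<bar>l\<bar> \<le> \<bar>l\<bar> ^ 3" using g(5) by (rule le_power3)
    have "1 - noconf ((1 + eps n l) / (2 * real n)) n 1
        \<le> vartheta (eps n l) * (1 + 3 / (real n * eps n l ^ 3))"
      using supercritical_upper[OF f(2,3) g(1) refl _ \<theta>] f(4) g(5) l3 by simp
    also have "\<dots> \<le> vartheta (eps n l) * (1 + 3 / \<bar>l\<bar>)"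
      unfolding f(4) using \<theta>(1) g(5) l3
      by (intro mult_left_mono add_left_mono divide_left_mono mult_pos_pos) auto
    finally show "reach_prob n (edge_prob n l) x / vartheta (eps n l) \<le> 1 + 3 / \<bar>l\<bar>"
      using \<theta>(1) by (simp add: f(5) divide_le_eq mult.commute)
    show "0 \<le> reach_prob n (edge_prob n l) x / vartheta (eps n l)"
      using \<theta>(1) by (intro divide_nonneg_pos) (auto simp: reach_prob_def)
  qed
  show "\<bar>\<delta> z\<bar> \<le> 3" if zR: "z \<in> super_regime 1 (1 / 100)"
  proof -
    obtain n l x where z: "z = (n, l, x)" by (cases z)
    have "1 \<le> \<bar>l\<bar>" using regime_facts(5) super_regime_facts(1) zR z by blast
    then have "3 / \<bar>l\<bar> \<le> 3" by (simp add: divide_le_eq)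
    then show ?thesis using le ge zR unfolding z \<delta>_def by (fastforce simp: abs_le_iff)
  qed
  assume c: "0 < c"
  define \<eta> where "\<eta> = min c (1 / 2)"
  have \<eta>: "0 < \<eta>" "\<eta> \<le> 1 / 2" "\<eta> \<le> c" using c by (auto simp: \<eta>_def)
  obtain \<Lambda> where low: "\<forall>n e \<theta>. 1 \<le> n \<longrightarrow> 0 < e \<longrightarrow> e \<le> 1 / 100 \<longrightarrow> \<Lambda> \<le> real n * e ^ 3 \<longrightarrow>
    0 < \<theta> \<longrightarrow> \<theta> < 1 \<longrightarrow> 1 - \<theta> = exp (- (1 + e) * \<theta>) \<longrightarrow>
    (1 - \<eta>) * \<theta> \<le> 1 - noconf ((1 + e) / (2 * real n)) n 1"
    using supercritical_lower[OF \<eta>(1,2)] by blast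
  show "eventually (\<lambda>z. z \<in> super_regime 1 (1 / 100) \<longrightarrow> \<bar>\<delta> z\<bar> \<le> c) lambda_large"
    using eventually_lambda_large[of \<Lambda>] eventually_lambda_large[of "3 / c"]
  proof eventually_elim
    case (elim z)
    show ?case
    proof
      obtain n l x where z: "z = (n, l, x)" by (cases z)
      assume "z \<in> super_regime 1 (1 / 100)"
      then have zR: "(n, l, x) \<in> super_regime 1 (1 / 100)" by (simp add: z)
      note f = super_regime_facts[OF zR] and g = regime_facts[OF super_regime_facts(1)[OF zR]]
      note \<theta> = vartheta_root[OF f(2)]
      have "\<Lambda> \<le> real n * eps n l ^ 3"
        using elim(1) le_power3[OF g(5)] by (simp add: z f(4))
      from low[rule_format, OF g(1) f(2,3) this \<theta>]
      have "1 - \<eta> \<le> reach_prob n (edge_prob n l) x / vartheta (eps n l)"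
        using \<theta>(1) by (simp add: f(5) le_divide_eq)
      moreover have "3 / \<bar>l\<bar> \<le> c"
        using elim(2) c g(5) by (simp add: z field_simps)
      ultimately show "\<bar>\<delta> z\<bar> \<le> c" using le[OF zR] \<eta> by (auto simp: \<delta>_def z abs_le_iff)
    qed
  qed
qed

text \<open>The witnesses are 1 and 1/100: the latter is the range of e in the analytic estimates,
  and |\<lambda>| at least 1 makes |\<lambda>|^3 at least |\<lambda>|, so that large |\<lambda>|
  gives large n |e|^3.\<close>

theorem theorem3p1:
  shows "\<exists>l0 e0 :: real. 0 < l0 \<and> 0 < e0 \<and> e0 < 1 \<and>
    (\<exists>\<delta> \<in> little_o_on (inf lambda_large eps_small) (sub_regime l0 e0) (\<lambda>_. 1).
       \<forall>(n, l, x) \<in> sub_regime l0 e0.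
         reach_prob n (edge_prob n l) x
           = real n powr (-1/3) / (4 * l\<^sup>2) * (1 + \<delta> (n, l, x))) \<and>
    (\<exists>\<delta>1 \<in> little_o_on lambda_large (super_regime l0 e0) (\<lambda>_. 1).
     \<exists>\<delta>2 \<in> little_o_on lambda_large (super_regime l0 e0) (\<lambda>_. 1).
     \<exists>\<beta> \<in> O[principal (super_regime l0 e0)](\<lambda>(n, l, x). eps n l).
       \<forall>(n, l, x) \<in> super_regime l0 e0.
         reach_prob n (edge_prob n l) x = vartheta (eps n l) * (1 + \<delta>1 (n, l, x)) \<and>
         vartheta (eps n l) * (1 + \<delta>1 (n, l, x))
           = 2 * l * real n powr (-1/3) * (1 + \<delta>2 (n, l, x) + \<beta> (n, l, x)))"
proof (rule exI[of _ 1], rule exI[of _ "1 / 100"], intro conjI)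
  show "\<exists>\<delta> \<in> little_o_on (inf lambda_large eps_small) (sub_regime 1 (1 / 100)) (\<lambda>_. 1).
       \<forall>(n, l, x) \<in> sub_regime 1 (1 / 100).
         reach_prob n (edge_prob n l) x
           = real n powr (-1/3) / (4 * l\<^sup>2) * (1 + \<delta> (n, l, x))"
  proof (rule bexI[OF _ subcritical_case], clarify)
    fix n l x assume z: "(n, l, x) \<in> sub_regime 1 (1 / 100)"
    have "P = q * (1 + (P / q - 1))" if "0 < q" for P q :: real
      using that by simp
    from this[OF sub_regime_facts(6)[OF z]]
    show "reach_prob n (edge_prob n l) x = real n powr (-1/3) / (4 * l\<^sup>2) *
      (1 + (reach_prob n (edge_prob n l) x / (real n powr (-1/3) / (4 * l\<^sup>2)) - 1))" .
  qed
next
  let ?R = "super_regime 1 (1 / 100)"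
  define \<delta>1 where "\<delta>1 = (\<lambda>(n, l, x::literal). reach_prob n (edge_prob n l) x / vartheta (eps n l) - 1)"
  \<comment> \<open>Writing \<theta> = 2 \<epsilon> \<rho> gives \<rho> (1 + \<delta>1) = 1 + \<rho>
    \<delta>1 + (\<rho> - 1), which dictates both remaining witnesses. The bounds of
    \<open>survival_root_bounds\<close> place \<rho> between 1 - 4 \<epsilon> and 1.\<close>
  define \<rho> where "\<rho> = (\<lambda>(n, l, x::literal). vartheta (eps n l) / (2 * eps n l))"
  define \<delta>2 where "\<delta>2 = (\<lambda>z. \<delta>1 z * \<rho> z)"
  define \<beta> where "\<beta> = (\<lambda>z. \<rho> z - 1)"
  note \<delta>1 = supercritical_case[folded \<delta>1_def]
  have \<rho>: "0 \<le> \<rho> z" "\<rho> z \<le> 1" "\<bar>\<beta> z\<bar> \<le> 4 * \<bar>case z of (n, l, x) \<Rightarrow> eps n l\<bar>" if "z \<in> ?R" for z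
  proof -
    obtain n l x where z: "z = (n, l, x)" by (cases z)
    note f = super_regime_facts[OF that[unfolded z]]
    note \<theta> = vartheta_root[OF f(2)]
    note b = survival_root_bounds[OF f(2,3) \<theta>]
    have 1: "vartheta (eps n l) / (2 * eps n l) \<le> 1" using b(2) f(2) by (simp add: divide_le_eq)
    have 2: "1 - 4 * eps n l \<le> vartheta (eps n l) / (2 * eps n l)"
      using b(3) f(2) by (simp add: le_divide_eq power2_eq_square algebra_simps)
    show "0 \<le> \<rho> z" "\<rho> z \<le> 1" using 1 f(2) \<theta>(1) by (auto simp: \<rho>_def z)
    show "\<bar>\<beta> z\<bar> \<le> 4 * \<bar>case z of (n, l, x) \<Rightarrow> eps n l\<bar>"
      using 1 2 f(2) by (auto simp: \<beta>_def \<rho>_def z abs_le_iff)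
  qed
  have \<delta>2: "\<bar>\<delta>2 z\<bar> \<le> \<bar>\<delta>1 z\<bar>" if "z \<in> ?R" for z
    using \<rho>[OF that] by (simp add: \<delta>2_def abs_mult mult_left_le)
  have "\<delta>1 \<in> little_o_on lambda_large ?R (\<lambda>_. 1)"
    using \<delta>1 by (intro little_o_on_1I[where C = 3])
  moreover have "\<delta>2 \<in> little_o_on lambda_large ?R (\<lambda>_. 1)"
  proof (rule little_o_on_1I[where C = 3])
    show "\<bar>\<delta>2 z\<bar> \<le> 3" if "z \<in> ?R" for z
      using \<delta>1(1)[OF that] \<delta>2[OF that] by linarith
    show "eventually (\<lambda>z. z \<in> ?R \<longrightarrow> \<bar>\<delta>2 z\<bar> \<le> c) lambda_large" if "0 < c" for c
      using \<delta>1(2)[OF that] by eventually_elim (use \<delta>2 in force)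
  qed
  moreover have "\<beta> \<in> O[principal ?R](\<lambda>(n, l, x). eps n l)"
    using \<rho>(3) by (intro bigoI[of _ 4]) (auto simp: eventually_principal)
  moreover have "\<forall>(n, l, x) \<in> ?R.
         reach_prob n (edge_prob n l) x = vartheta (eps n l) * (1 + \<delta>1 (n, l, x)) \<and>
         vartheta (eps n l) * (1 + \<delta>1 (n, l, x))
           = 2 * l * real n powr (-1/3) * (1 + \<delta>2 (n, l, x) + \<beta> (n, l, x))"
  proof (clarify, intro conjI)
    fix n l x assume z: "(n, l, x) \<in> ?R"
    note f = super_regime_facts[OF z]
    note \<theta> = vartheta_root[OF f(2)]
    show "reach_prob n (edge_prob n l) x = vartheta (eps n l) * (1 + \<delta>1 (n, l, x))"
      using \<theta>(1) by (simp add: \<delta>1_def)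
    have "2 * l * real n powr (-1/3) * (1 + \<delta>2 (n, l, x) + \<beta> (n, l, x))
        = (2 * eps n l * \<rho> (n, l, x)) * (1 + \<delta>1 (n, l, x))"
      by (simp add: eps_def \<delta>2_def \<beta>_def algebra_simps)
    also have "2 * eps n l * \<rho> (n, l, x) = vartheta (eps n l)" using f(2) by (simp add: \<rho>_def)
    finally show "vartheta (eps n l) * (1 + \<delta>1 (n, l, x))
        = 2 * l * real n powr (-1/3) * (1 + \<delta>2 (n, l, x) + \<beta> (n, l, x))" ..
  qed
  ultimately show "\<exists>\<delta>1 \<in> little_o_on lambda_large ?R (\<lambda>_. 1).
     \<exists>\<delta>2 \<in> little_o_on lambda_large ?R (\<lambda>_. 1).
     \<exists>\<beta> \<in> O[principal ?R](\<lambda>(n, l, x). eps n l).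
       \<forall>(n, l, x) \<in> ?R.
         reach_prob n (edge_prob n l) x = vartheta (eps n l) * (1 + \<delta>1 (n, l, x)) \<and>
         vartheta (eps n l) * (1 + \<delta>1 (n, l, x))
           = 2 * l * real n powr (-1/3) * (1 + \<delta>2 (n, l, x) + \<beta> (n, l, x))"
    by blast
qed simp_all

end
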